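(* Let $L>0$, $T>0$, $W^0\in\widehat H^0(\mathbb R^2)$, $W^T\in\widehat H^0(\mathbb R^2)$, and put $W_0^T=W^T-\mathcal W_0(\cdot,T)$. Suppose that $W_0^T\in\mathcal H$ and that $$|W_0^T(x)|\le\frac L{2\pi}e^{-\frac{|x|^2}{4T}}\ln\left(1+\frac{4T}{|x|^2}\right),\quad x\in\mathbb R^2\setminus\{0\}.$$ Let $$\omega_n=-2\frac{n!}{(2n)!}\int_0^\infty\int_0^\infty x_1^{2n}W_0^T(x_1,x_2)\,dx_1\,dx_2,\quad n=0,1,2,\dots.$$ If for each $N\in\mathbb N$ there exists $u_N\in L^\infty(0,T)$ with $\|u_N\|_{L^\infty(0,T)}\le L$ such that $$\int_0^T\xi^nu_N(T-\xi)\,d\xi=\omega_n,\quad n=0,1,\dots,N,$$ then the state $W^0$ is approximately controllable to the target state $W^T$ in the given time $T$.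
   Context: $\mathbb R_+=(0,+\infty)$; function spaces are complex; pointwise bounds on $L^2$ functions are understood a.e. $\widehat H^0(\mathbb R^2)$ is the subspace of $L^2(\mathbb R^2)$ (with the $L^2$ norm) of functions even with respect to $x_1$. $\mathcal H=\{f\in L^2(\mathbb R^2): \exists g\in L^2(\mathbb R_+),\ f(x)=g(|x|^2)\text{ a.e. on }\mathbb R^2\}$. For $W^0\in\widehat H^0(\mathbb R^2)$ and $u\in L^\infty(0,T)$ put $$\mathcal W_0(\cdot,T)=\frac1{4\pi T}e^{-\frac{|\cdot|^2}{4T}}*W^0,\qquad \mathcal W_u(x,T)=-\frac1\pi\int_0^T\frac1{2\xi}e^{-\frac{|x|^2}{4\xi}}u(T-\xi)\,d\xi .$$ Then $W(\cdot,T)=\mathcal W_0(\cdot,T)+\mathcal W_u(\cdot,T)$ is the state at time $T$ of the unique solution of the control system $W_t=\Delta W-2\delta u(t)$, $W(\cdot,0)=W^0$ on $\mathbb R^2$. Let $$\mathcal R_T(W^0)=\{V\in\widehat H^0(\mathbb R^2):\exists u\in L^\infty(0,T),\ V=\mathcal W_0(\cdot,T)+\mathcal W_u(\cdot,T)\}.$$ $W^0$ is approximately controllable to $W^T$ in time $T$ if $W^T\in\overline{\mathcal R_T(W^0)}$ (closure in $\widehat H^0(\mathbb R^2)$). *)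

theory Defs
  imports "HOL-Analysis.Analysis" "HOL-Probability.Essential_Supremum"
begin

text \<open>
  Elements of the \<open>L\<^sup>2\<close> and \<open>L\<^sup>\<infinity>\<close> spaces are represented by complex-valued, Borel measurable
  functions; equality of elements is equality almost everywhere. The plane is
  \<^typ>\<open>real \<times> real\<close>, whose \<^const>\<open>norm\<close> is the Euclidean one.
\<close>

definition L2 :: "'a measure \<Rightarrow> ('a \<Rightarrow> complex) set" where
  "L2 M = {f \<in> borel_measurable M. integrable M (\<lambda>x. (cmod (f x))\<^sup>2)}"

definition L2_norm :: "'a measure \<Rightarrow> ('a \<Rightarrow> complex) \<Rightarrow> real" where
  "L2_norm M f = sqrt (LINT x|M. (cmod (f x))\<^sup>2)"

definition Linf_norm :: "'a measure \<Rightarrow> ('a \<Rightarrow> complex) \<Rightarrow> ereal" where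
  "Linf_norm M f = esssup M (\<lambda>x. ereal (cmod (f x)))"

definition Linf :: "'a measure \<Rightarrow> ('a \<Rightarrow> complex) set" where
  "Linf M = {f \<in> borel_measurable M. Linf_norm M f < \<infinity>}"

abbreviation lborel_interval :: "real \<Rightarrow> real measure" where
  "lborel_interval T \<equiv> restrict_space lborel {0<..<T}"

definition hat_H0 :: "(real \<times> real \<Rightarrow> complex) set" where
  "hat_H0 = {f \<in> L2 lborel. AE x in lborel. f (- fst x, snd x) = f x}"

definition cal_H :: "(real \<times> real \<Rightarrow> complex) set" where
  "cal_H = {f \<in> L2 lborel. \<exists>g \<in> L2 (restrict_space lborel {0<..}).
              AE x in lborel. f x = g ((norm x)\<^sup>2)}"

definition convolution ::
    "('a::euclidean_space \<Rightarrow> complex) \<Rightarrow> ('a \<Rightarrow> complex) \<Rightarrow> 'a \<Rightarrow> complex" where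
  "convolution f g x = (LINT y|lborel. f (x - y) * g y)"

text \<open>
  \<open>W_free W0 T + W_ctrl u T\<close> is the state at time \<open>T\<close> of \<open>W\<^sub>t = \<Delta>W - 2 \<delta> u(t)\<close>, \<open>W(\<cdot>, 0) = W0\<close>,
  on the plane. At \<open>x = 0\<close> the integral in \<open>W_ctrl\<close> need not converge; this affects only a
  null set.
\<close>

definition W_free :: "(real \<times> real \<Rightarrow> complex) \<Rightarrow> real \<Rightarrow> real \<times> real \<Rightarrow> complex" where
  "W_free W0 T =
     convolution (\<lambda>x. complex_of_real (1 / (4 * pi * T) * exp (- (norm x)\<^sup>2 / (4 * T)))) W0"

definition W_ctrl :: "(real \<Rightarrow> complex) \<Rightarrow> real \<Rightarrow> real \<times> real \<Rightarrow> complex" where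
  "W_ctrl u T x =
     - complex_of_real (1 / pi) * (LINT \<xi>:{0<..<T}|lborel.
         complex_of_real (1 / (2 * \<xi>) * exp (- (norm x)\<^sup>2 / (4 * \<xi>))) * u (T - \<xi>))"

definition reachable :: "real \<Rightarrow> (real \<times> real \<Rightarrow> complex) \<Rightarrow> (real \<times> real \<Rightarrow> complex) set" where
  "reachable T W0 = {V \<in> hat_H0. \<exists>u \<in> Linf (lborel_interval T).
                       AE x in lborel. V x = W_free W0 T x + W_ctrl u T x}"

definition hat_H0_closure ::
    "(real \<times> real \<Rightarrow> complex) set \<Rightarrow> (real \<times> real \<Rightarrow> complex) set" where
  "hat_H0_closure S = {f \<in> hat_H0. \<forall>\<epsilon>>0. \<exists>g\<in>S. L2_norm lborel (\<lambda>x. f x - g x) < \<epsilon>}"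

definition approx_controllable ::
    "(real \<times> real \<Rightarrow> complex) \<Rightarrow> (real \<times> real \<Rightarrow> complex) \<Rightarrow> real \<Rightarrow> bool" where
  "approx_controllable W0 WT T \<longleftrightarrow> WT \<in> hat_H0_closure (reachable T W0)"

definition omega :: "(real \<times> real \<Rightarrow> complex) \<Rightarrow> nat \<Rightarrow> complex" where
  "omega F n = - 2 * (fact n / fact (2 * n)) *
     (LINT x2:{0<..}|lborel. (LINT x1:{0<..}|lborel. complex_of_real (x1 ^ (2 * n)) * F (x1, x2)))"

end

theory Submission
  imports Defs "HOL-Probability.Distributions" "HOL-Real_Asymp.Real_Asymp"
begin

text \<open>
  Put \<open>h\<^sub>N = W\<^sub>0\<^sup>T - \<W>\<^sub>u\<close> with \<open>u = u\<^sub>N\<close>. These functions are radial and dominated by a fixed multiple of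
  \<open>E(x) = \<integral>\<^sub>0\<^sup>T (2 \<pi> \<xi>)\<^sup>-\<^sup>1 exp (- |x|\<^sup>2 / 4 \<xi>) d\<xi>\<close>, and the moment conditions say exactly that the moments
  \<open>\<integral> |x|\<^sup>2\<^sup>n h\<^sub>N\<close>, \<open>n \<le> N\<close>, vanish. As \<open>E\<close> decays like a Gaussian, this forces \<open>\<integral> h\<^sub>N \<psi> \<longlonglongrightarrow> 0\<close> for every
  radial \<open>\<psi>\<close> with \<open>E \<psi>\<close> integrable. The convergence is in fact strong:
  \<open>\<parallel>h\<^sub>N\<parallel>\<^sup>2 = \<langle>h\<^sub>N, W\<^sub>0\<^sup>T\<rangle> - \<langle>h\<^sub>N, \<W>\<^sub>u\<rangle>\<close>, where the first term tends to 0 because \<open>W\<^sub>0\<^sup>T\<close> is radial, and the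
  second one is by Fubini at most \<open>L \<integral>\<^sub>0\<^sup>T |\<langle>h\<^sub>N, K\<^sub>\<xi>\<rangle>| d\<xi>\<close> for the radial Gaussians \<open>K\<^sub>\<xi>\<close>, so that dominated
  convergence applies.
\<close>

section \<open>Weak convergence from vanishing moments\<close>

lemma
  fixes f :: "'a \<Rightarrow> 'b::{banach, second_countable_topology}"
  assumes "f \<in> borel_measurable M" and g: "integrable M g" and le: "AE x in M. norm (f x) \<le> g x"
  shows integrable_dominated: "integrable M f"
    and norm_integral_dominated: "norm (integral\<^sup>L M f) \<le> integral\<^sup>L M g"
proof -
  show f: "integrable M f"
    by (rule Bochner_Integration.integrable_bound[OF g assms(1)]) (use le in \<open>auto elim!: eventually_mono\<close>)
  show "norm (integral\<^sup>L M f) \<le> integral\<^sup>L M g"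
    by (rule order_trans[OF integral_norm_bound integral_mono_AE[OF integrable_norm[OF f] g le]])
qed

text \<open>One term of the exponential series at \<open>\<delta> * y\<close> is at most the whole
  sum. This trades a polynomial factor for an arbitrarily small loss in the exponent.\<close>

lemma power_le_exp:
  fixes y :: real
  assumes "0 \<le> y" "0 < \<delta>"
  shows "y ^ j \<le> fact j / \<delta> ^ j * exp (\<delta> * y)"
proof -
  have "(\<delta> * y) ^ j / fact j \<le> exp (\<delta> * y)"
    unfolding exp_def using assms
      sum_le_suminf[OF summable_exp_generic[of "\<delta> * y"], of "{j}"]
    by (simp add: divide_inverse mult.commute)
  then show ?thesis using assms by (simp add: field_simps power_mult_distrib)
qed

text \<open>A moment problem made determinate by the exponential moment of the majorant
  \<open>w\<close>. Keeping \<open>q\<close> abstract (later it is the squared norm on the plane)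
  avoids polar coordinates. The moments tend to 0 for each fixed \<open>n\<close>, with no
  uniformity in \<open>n\<close>.\<close>

locale vanishing_moments =
  fixes M :: "'a measure" and q w :: "'a \<Rightarrow> real" and h :: "nat \<Rightarrow> 'a \<Rightarrow> complex" and a :: real
  assumes q_measurable [measurable]: "q \<in> borel_measurable M"
    and w_measurable [measurable]: "w \<in> borel_measurable M"
    and h_measurable [measurable]: "\<And>N. h N \<in> borel_measurable M"
    and q_nonneg: "\<And>x. 0 \<le> q x"
    and a_pos: "0 < a"
    and h_le_w: "\<And>N. AE x in M. cmod (h N x) \<le> w x"
    and w_exp_integrable: "integrable M (\<lambda>x. w x * exp (a * q x))"
    and moments_tendsto: "\<And>n. (\<lambda>N. LINT x|M. h N x * complex_of_real (q x ^ n)) \<longlonglongrightarrow> 0"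
begin

text \<open>Integrability of \<open>w * cmod \<psi>\<close> makes the pairings with
  \<open>h N\<close> genuine integrals rather than the default value 0, with a bound uniform in
  \<open>N\<close>; this uniformity is what survives limits in \<open>\<psi>\<close>.\<close>

definition weak_null :: "('a \<Rightarrow> complex) \<Rightarrow> bool" where
  "weak_null \<psi> \<longleftrightarrow> \<psi> \<in> borel_measurable M \<and> integrable M (\<lambda>x. w x * cmod (\<psi> x)) \<and>
     (\<lambda>N. LINT x|M. h N x * \<psi> x) \<longlonglongrightarrow> 0"

lemma AE_w_nonneg: "AE x in M. 0 \<le> w x"
  using h_le_w[of 0] by eventually_elim (use norm_ge_zero order_trans in blast)

lemma
  assumes [measurable]: "\<psi> \<in> borel_measurable M" and "integrable M (\<lambda>x. w x * cmod (\<psi> x))"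
  shows h_mult_integrable: "integrable M (\<lambda>x. h N x * \<psi> x)"
    and h_mult_bound: "cmod (LINT x|M. h N x * \<psi> x) \<le> (LINT x|M. w x * cmod (\<psi> x))"
proof -
  have le: "AE x in M. cmod (h N x * \<psi> x) \<le> w x * cmod (\<psi> x)"
    using h_le_w[of N] by eventually_elim (simp add: norm_mult mult_right_mono)
  show "integrable M (\<lambda>x. h N x * \<psi> x)"
    by (rule integrable_dominated[OF _ assms(2) le]) measurable
  show "cmod (LINT x|M. h N x * \<psi> x) \<le> (LINT x|M. w x * cmod (\<psi> x))"
    by (rule norm_integral_dominated[OF _ assms(2) le]) measurable
qed

text \<open>Replacing \<open>\<phi>\<close> by \<open>\<psi> m\<close> costs at most the integral of
  \<open>w * cmod (\<phi> - \<psi> m)\<close>, whatever \<open>N\<close> is, and this tends to 0 by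
  dominated convergence with majorant \<open>2 * w * B\<close>. Choosing \<open>m\<close> first and
  \<open>N\<close> afterwards interchanges the limits.\<close>

lemma weak_null_lim:
  assumes \<psi>: "\<And>m. weak_null (\<psi> m)" and [measurable]: "\<phi> \<in> borel_measurable M"
    and lim: "\<And>x. (\<lambda>m. \<psi> m x) \<longlonglongrightarrow> \<phi> x"
    and bound: "\<And>m x. cmod (\<psi> m x) \<le> B x" and B: "integrable M (\<lambda>x. w x * B x)"
  shows "weak_null \<phi>"
proof -
  have [measurable]: "\<psi> m \<in> borel_measurable M" for m
    using \<psi> by (simp add: weak_null_def)
  have B': "cmod (\<phi> x) \<le> B x" for x
    by (rule LIMSEQ_le_const2[OF tendsto_norm[OF lim]]) (use bound in auto)
  have int: "integrable M (\<lambda>x. w x * cmod (f x))"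
    if "f \<in> borel_measurable M" "\<And>x. cmod (f x) \<le> c * B x" for f :: "'a \<Rightarrow> complex" and c
  proof (rule Bochner_Integration.integrable_bound[OF integrable_mult_right[OF B, of c]])
    show "AE x in M. norm (w x * cmod (f x)) \<le> norm (c * (w x * B x))"
      using AE_w_nonneg
    proof eventually_elim
      case (elim x)
      from mult_left_mono[OF that(2)[of x] elim] elim show ?case
        by (simp add: mult.left_commute)
    qed
  qed (use that in measurable)
  have int\<phi>: "integrable M (\<lambda>x. w x * cmod (\<phi> x))"
    by (rule int[where c = 1]) (use B' in auto)
  have B2: "cmod (\<phi> x - \<psi> m x) \<le> 2 * B x" for m x
    using norm_triangle_ineq4[of "\<phi> x" "\<psi> m x"] B'[of x] bound[of m x] by linarith
  have intd: "integrable M (\<lambda>x. w x * cmod (\<phi> x - \<psi> m x))" for m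
    by (rule int[where c = 2]) (use B2 in auto)
  have "(\<lambda>m. LINT x|M. w x * cmod (\<phi> x - \<psi> m x)) \<longlonglongrightarrow> (LINT x|M. 0)"
  proof (rule integral_dominated_convergence)
    show "integrable M (\<lambda>x. 2 * (w x * B x))" using B by simp
    show "AE x in M. (\<lambda>m. w x * cmod (\<phi> x - \<psi> m x)) \<longlonglongrightarrow> 0"
    proof (rule AE_I2)
      fix x
      have "(\<lambda>m. w x * cmod (\<phi> x - \<psi> m x)) \<longlonglongrightarrow> w x * cmod (\<phi> x - \<phi> x)"
        by (intro tendsto_intros lim)
      then show "(\<lambda>m. w x * cmod (\<phi> x - \<psi> m x)) \<longlonglongrightarrow> 0" by simp
    qed
    show "AE x in M. norm (w x * cmod (\<phi> x - \<psi> m x)) \<le> 2 * (w x * B x)" for m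
      using AE_w_nonneg
    proof eventually_elim
      case (elim x)
      then show ?case using mult_left_mono[OF B2[of x m], of "w x"] by (simp add: abs_mult ac_simps)
    qed
  qed auto
  then have e0: "(\<lambda>m. LINT x|M. w x * cmod (\<phi> x - \<psi> m x)) \<longlonglongrightarrow> 0" by simp
  have "(\<lambda>N. LINT x|M. h N x * \<phi> x) \<longlonglongrightarrow> 0"
  proof (rule metric_LIMSEQ_I)
    fix e :: real assume "0 < e"
    then obtain m where m: "(LINT x|M. w x * cmod (\<phi> x - \<psi> m x)) < e / 2"
      using order_tendstoD(2)[OF e0, of "e / 2"] by (auto simp: eventually_sequentially)
    from \<psi>[of m] have "(\<lambda>N. LINT x|M. h N x * \<psi> m x) \<longlonglongrightarrow> 0" by (simp add: weak_null_def)
    then obtain N0 where N0: "\<And>N. N \<ge> N0 \<Longrightarrow> cmod (LINT x|M. h N x * \<psi> m x) < e / 2"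
      using \<open>0 < e\<close> metric_LIMSEQ_D[of _ 0 "e / 2"] by fastforce
    show "\<exists>N0. \<forall>N\<ge>N0. dist (LINT x|M. h N x * \<phi> x) 0 < e"
    proof (intro exI allI impI)
      fix N assume "N \<ge> N0"
      have "(LINT x|M. h N x * \<phi> x) = (LINT x|M. h N x * \<psi> m x + h N x * (\<phi> x - \<psi> m x))"
        by (simp add: algebra_simps)
      also have "\<dots> = (LINT x|M. h N x * \<psi> m x) + (LINT x|M. h N x * (\<phi> x - \<psi> m x))"
        using \<psi>[of m] by (intro Bochner_Integration.integral_add h_mult_integrable intd)
          (auto simp: weak_null_def)
      finally have "cmod (LINT x|M. h N x * \<phi> x)
          \<le> cmod (LINT x|M. h N x * \<psi> m x) + cmod (LINT x|M. h N x * (\<phi> x - \<psi> m x))"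
        by (simp only: norm_triangle_ineq)
      also have "cmod (LINT x|M. h N x * (\<phi> x - \<psi> m x)) \<le> (LINT x|M. w x * cmod (\<phi> x - \<psi> m x))"
        by (rule h_mult_bound[OF _ intd]) measurable
      finally show "dist (LINT x|M. h N x * \<phi> x) 0 < e"
        using N0[OF \<open>N \<ge> N0\<close>] m by simp
    qed
  qed
  with int\<phi> show ?thesis by (simp add: weak_null_def)
qed

section \<open>Closure of the weakly null functions under linear combinations and
  exponentials\<close>

lemma weak_null_add:
  assumes "weak_null \<phi>" "weak_null \<psi>"
  shows "weak_null (\<lambda>x. \<phi> x + \<psi> x)"
proof -
  have [measurable]: "\<phi> \<in> borel_measurable M" "\<psi> \<in> borel_measurable M"
    and i: "integrable M (\<lambda>x. w x * cmod (\<phi> x))" "integrable M (\<lambda>x. w x * cmod (\<psi> x))"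
    using assms by (auto simp: weak_null_def)
  have "integrable M (\<lambda>x. w x * cmod (\<phi> x + \<psi> x))"
  proof (rule Bochner_Integration.integrable_bound[OF Bochner_Integration.integrable_add[OF i]])
    show "AE x in M. norm (w x * cmod (\<phi> x + \<psi> x)) \<le> norm (w x * cmod (\<phi> x) + w x * cmod (\<psi> x))"
      using AE_w_nonneg
    proof eventually_elim
      case (elim x)
      from mult_left_mono[OF norm_triangle_ineq[of "\<phi> x" "\<psi> x"] elim] elim show ?case
        by (simp add: distrib_left)
    qed
  qed measurable
  moreover have "(LINT x|M. h N x * (\<phi> x + \<psi> x)) = (LINT x|M. h N x * \<phi> x) + (LINT x|M. h N x * \<psi> x)" for N
    unfolding distrib_left
    by (intro Bochner_Integration.integral_add h_mult_integrable i) measurable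
  moreover have "(\<lambda>N. (LINT x|M. h N x * \<phi> x) + (LINT x|M. h N x * \<psi> x)) \<longlonglongrightarrow> 0 + 0"
    using assms by (intro tendsto_add) (auto simp: weak_null_def)
  ultimately show ?thesis by (simp add: weak_null_def)
qed

lemma weak_null_cmult:
  assumes "weak_null \<phi>"
  shows "weak_null (\<lambda>x. c * \<phi> x)"
proof -
  have "integrable M (\<lambda>x. cmod c * (w x * cmod (\<phi> x)))"
    using assms by (auto simp: weak_null_def)
  moreover have "(\<lambda>N. c * (LINT x|M. h N x * \<phi> x)) \<longlonglongrightarrow> c * 0"
    using assms by (intro tendsto_intros) (auto simp: weak_null_def)
  moreover have [measurable]: "\<phi> \<in> borel_measurable M"
    using assms by (simp add: weak_null_def)
  ultimately show ?thesis
    by (simp add: weak_null_def norm_mult mult.left_commute)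
qed

lemma weak_null_0: "weak_null (\<lambda>x. 0)"
  by (simp add: weak_null_def)

lemma weak_null_sum:
  assumes "\<And>i. i \<in> I \<Longrightarrow> weak_null (\<phi> i)"
  shows "weak_null (\<lambda>x. \<Sum>i\<in>I. \<phi> i x)"
  using assms by (induction I rule: infinite_finite_induct) (auto simp: weak_null_0 weak_null_add)

text \<open>All partial sums of the series of \<open>exp (c * f)\<close> are dominated by
  \<open>exp (\<bar>c\<bar> * \<bar>f\<bar>)\<close>, so \<open>weak_null_lim\<close> applies. It
  serves with \<open>f = q\<close> and also with \<open>f\<close> a decaying exponential of
  \<open>q\<close>.\<close>

lemma weak_null_exp_mult:
  fixes f :: "'a \<Rightarrow> real"
  assumes \<phi>: "\<And>i. weak_null (\<lambda>x. complex_of_real (f x ^ i) * \<phi> x)"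
    and [measurable]: "f \<in> borel_measurable M"
    and int: "integrable M (\<lambda>x. w x * (exp (\<bar>c\<bar> * \<bar>f x\<bar>) * cmod (\<phi> x)))"
  shows "weak_null (\<lambda>x. complex_of_real (exp (c * f x)) * \<phi> x)"
proof -
  have [measurable]: "\<phi> \<in> borel_measurable M"
    using \<phi>[of 0] by (simp add: weak_null_def)
  define p where "p m x = (\<Sum>i<m. (c * f x) ^ i / fact i)" for m x
  show ?thesis
  proof (rule weak_null_lim[OF _ _ _ _ int])
    fix m
    have "weak_null (\<lambda>x. \<Sum>i<m. complex_of_real (c ^ i / fact i) * (complex_of_real (f x ^ i) * \<phi> x))"
      by (intro weak_null_sum weak_null_cmult \<phi>)
    then show "weak_null (\<lambda>x. complex_of_real (p m x) * \<phi> x)"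
      by (simp add: p_def sum_distrib_right power_mult_distrib mult.assoc)
  next
    fix x
    have "(\<lambda>m. p m x) \<longlonglongrightarrow> exp (c * f x)"
      using exp_converges[of "c * f x"] by (simp add: p_def sums_def divide_inverse mult.commute)
    then show "(\<lambda>m. complex_of_real (p m x) * \<phi> x) \<longlonglongrightarrow> complex_of_real (exp (c * f x)) * \<phi> x"
      by (intro tendsto_intros)
  next
    fix m x
    have "\<bar>p m x\<bar> \<le> (\<Sum>i<m. (\<bar>c\<bar> * \<bar>f x\<bar>) ^ i / fact i)"
      unfolding p_def by (rule order_trans[OF sum_abs]) (simp add: abs_mult power_abs power_mult_distrib)
    also have "\<dots> \<le> exp (\<bar>c\<bar> * \<bar>f x\<bar>)"
      unfolding exp_def
      using sum_le_suminf[OF summable_exp_generic[of "\<bar>c\<bar> * \<bar>f x\<bar>"], of "{..<m}"]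
      by (simp add: divide_inverse mult.commute)
    finally show "cmod (complex_of_real (p m x) * \<phi> x) \<le> exp (\<bar>c\<bar> * \<bar>f x\<bar>) * cmod (\<phi> x)"
      by (simp add: norm_mult mult_right_mono)
  qed measurable
qed

text \<open>The gap \<open>a - d\<close> absorbs the factor \<open>q ^ j\<close>, by
  \<open>power_le_exp\<close>.\<close>

lemma w_power_exp_integrable:
  assumes "d < a"
  shows "integrable M (\<lambda>x. w x * (q x ^ j * exp (d * q x)))"
proof -
  define \<delta> where "\<delta> = a - d"
  have \<delta>: "0 < \<delta>" using assms by (simp add: \<delta>_def)
  show ?thesis
  proof (rule Bochner_Integration.integrable_bound[OF integrable_mult_right[OF w_exp_integrable, of "fact j / \<delta> ^ j"]])
    show "AE x in M. norm (w x * (q x ^ j * exp (d * q x)))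
        \<le> norm (fact j / \<delta> ^ j * (w x * exp (a * q x)))"
      using AE_w_nonneg
    proof eventually_elim
      case (elim x)
      have "q x ^ j * exp (d * q x) \<le> fact j / \<delta> ^ j * exp (\<delta> * q x) * exp (d * q x)"
        by (intro mult_right_mono power_le_exp q_nonneg \<delta>) auto
      also have "\<dots> = fact j / \<delta> ^ j * exp (a * q x)"
        by (simp add: \<delta>_def mult_exp_exp algebra_simps)
      finally show ?case
        using elim \<delta> q_nonneg[of x] mult_left_mono[OF _ elim, of "q x ^ j * exp (d * q x)" "fact j / \<delta> ^ j * exp (a * q x)"]
        by (simp add: abs_mult mult.left_commute)
    qed
  qed measurable
qed

text \<open>
  Since \<open>w * exp (a * q)\<close> is integrable, the Taylor series of \<open>exp (- d * q)\<close> may be integrated against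
  \<open>h\<close> as long as \<open>d < a\<close>; a larger exponent is reached in several steps.
\<close>

lemma weak_null_power_exp:
  assumes "0 \<le> b"
  shows "weak_null (\<lambda>x. complex_of_real (q x ^ j * exp (- b * q x)))"
proof -
  \<comment> \<open>The rate \<open>b\<close> is split into \<open>n + 1\<close> equal steps
    \<open>d\<close>, and \<open>n \<ge> 2 * b / a\<close> makes each of them smaller than
    \<open>a\<close>. The added 1 keeps the quotient meaningful for \<open>b = 0\<close>.\<close>
  define n where "n = nat \<lceil>2 * b / a\<rceil>"
  define d where "d = b / (n + 1)"
  have d: "0 \<le> d" "d < a"
  proof -
    show "0 \<le> d" using assms by (simp add: d_def)
    have "2 * b / a \<le> n" using assms a_pos by (simp add: n_def)
    then have "2 * b \<le> n * a" using a_pos by (simp add: field_simps)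
    then have "b < (n + 1) * a" using a_pos assms by (simp add: algebra_simps)
    then show "d < a" by (simp add: d_def field_simps)
  qed
  \<comment> \<open>The power \<open>j\<close> has to vary in the induction, since the Taylor terms
    of one further step raise it to \<open>i + j\<close>.\<close>
  have "weak_null (\<lambda>x. complex_of_real (q x ^ j * exp (- (m * d) * q x)))" for m :: nat and j
  proof (induction m arbitrary: j)
    case 0
    show ?case
      using w_power_exp_integrable[of 0 j] a_pos moments_tendsto[of j] q_nonneg
      by (simp add: weak_null_def norm_mult norm_power)
  next
    case (Suc m)
    have "weak_null (\<lambda>x. complex_of_real (exp ((- d) * q x)) * complex_of_real (q x ^ j * exp (- (m * d) * q x)))"
    proof (rule weak_null_exp_mult)
      show "weak_null (\<lambda>x. complex_of_real (q x ^ i) * complex_of_real (q x ^ j * exp (- (m * d) * q x)))" for i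
        using Suc.IH[of "i + j"] by (simp add: power_add mult.assoc)
      show "integrable M (\<lambda>x. w x * (exp (\<bar>- d\<bar> * \<bar>q x\<bar>) * cmod (complex_of_real (q x ^ j * exp (- (m * d) * q x)))))"
      proof (rule Bochner_Integration.integrable_bound[OF w_power_exp_integrable[OF d(2), of j]])
        show "AE x in M. norm (w x * (exp (\<bar>- d\<bar> * \<bar>q x\<bar>) * cmod (complex_of_real (q x ^ j * exp (- (m * d) * q x)))))
            \<le> norm (w x * (q x ^ j * exp (d * q x)))"
          using AE_w_nonneg
        proof eventually_elim
          case (elim x)
          have "exp (- (m * d) * q x) \<le> 1" using d q_nonneg by simp
          then have "q x ^ j * exp (d * q x) * exp (- (m * d) * q x) \<le> q x ^ j * exp (d * q x)"
            using q_nonneg[of x] by (intro mult_left_le) auto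
          from mult_left_mono[OF this elim] show ?case
            using elim d(1) q_nonneg[of x] by (simp add: abs_mult norm_mult norm_power mult_ac)
        qed
      qed measurable
    qed measurable
    moreover have "exp ((- d) * q x) * (q x ^ j * exp (- (m * d) * q x)) = q x ^ j * exp (- (Suc m * d) * q x)" for x
      unfolding mult.left_commute[of "exp ((- d) * q x)"] mult_exp_exp by (simp add: algebra_simps)
    ultimately show ?case unfolding of_real_mult[symmetric] by (simp only:)
  qed
  from this[of j "n + 1"] show ?thesis by (simp add: d_def)
qed

lemma w_integrable: "integrable M w"
  using w_power_exp_integrable[of 0 0] a_pos by simp

section \<open>From exponentials to arbitrary functions of \<open>q\<close>\<close>

lemma weak_null_bounded_lim:
  assumes "\<And>m. weak_null (\<psi> m)" "\<phi> \<in> borel_measurable M"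
    and "\<And>x. (\<lambda>m. \<psi> m x) \<longlonglongrightarrow> \<phi> x" "\<And>m x. cmod (\<psi> m x) \<le> B"
  shows "weak_null \<phi>"
  by (rule weak_null_lim[where B = "\<lambda>_. B"]) (use assms w_integrable in auto)

text \<open>
  The indicator of \<open>{c<..}\<close> is the limit of \<open>exp (- m * exp (m * (c - q)))\<close>, which expands into powers of
  \<open>exp (- m * q)\<close>; the outer factor \<open>m\<close> makes the limit vanish at \<open>q = c\<close> as well.
\<close>

lemma weak_null_greaterThan: "weak_null (\<lambda>x. indicator {c<..} (q x))"
proof (rule weak_null_bounded_lim[where B = 1])
  fix m :: nat
  define C where "C = real m * exp (real m * c)"
  have "weak_null (\<lambda>x. complex_of_real (exp ((- C) * exp (- real m * q x))) * 1)"
  proof (rule weak_null_exp_mult)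
    show "weak_null (\<lambda>x. complex_of_real (exp (- real m * q x) ^ i) * 1)" for i
      using weak_null_power_exp[of "i * m" 0] by (simp add: mult.assoc flip: exp_of_nat_mult)
    show "integrable M (\<lambda>x. w x * (exp (\<bar>- C\<bar> * \<bar>exp (- real m * q x)\<bar>) * cmod 1))"
    proof (rule Bochner_Integration.integrable_bound[OF integrable_mult_right[OF w_integrable, of "exp \<bar>C\<bar>"]])
      have "exp (\<bar>C\<bar> * exp (- (m * q x))) \<le> exp \<bar>C\<bar>" for x
        using q_nonneg by (auto simp: mult_left_le)
      from mult_left_mono[OF this abs_ge_zero]
      show "AE x in M. norm (w x * (exp (\<bar>- C\<bar> * \<bar>exp (- real m * q x)\<bar>) * cmod 1)) \<le> norm (exp \<bar>C\<bar> * w x)"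
        by (simp add: abs_mult mult.commute)
    qed measurable
  qed measurable
  moreover have "(- C) * exp (- real m * q x) = - real m * exp (real m * (c - q x))" for x
    by (simp add: C_def mult.assoc mult_exp_exp algebra_simps)
  ultimately show "weak_null (\<lambda>x. complex_of_real (exp (- real m * exp (real m * (c - q x)))))"
    by simp
next
  fix x
  have "(\<lambda>m::nat. exp (- real m * exp (real m * (c - q x)))) \<longlonglongrightarrow> indicator {c<..} (q x)"
  proof (cases "c < q x")
    case True
    define \<delta> where "\<delta> = q x - c"
    have "0 < \<delta>" using True by (simp add: \<delta>_def)
    then have "(\<lambda>m::nat. exp (- real m * exp (real m * - \<delta>))) \<longlonglongrightarrow> 1"
      by real_asymp
    with True show ?thesis by (simp add: \<delta>_def)
  next
    case False
    then have "0 \<le> c - q x" by simp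
    have "(\<lambda>m::nat. exp (- real m * exp (real m * (c - q x)))) \<longlonglongrightarrow> 0"
    proof (rule tendsto_sandwich[where f = "\<lambda>_. 0" and h = "\<lambda>m::nat. exp (- real m)"])
      show "\<forall>\<^sub>F m in sequentially. exp (- real m * exp (real m * (c - q x))) \<le> exp (- real m)"
        using \<open>0 \<le> c - q x\<close> by (intro always_eventually) (auto simp: mult_le_cancel_left1)
      show "(\<lambda>m::nat. exp (- real m)) \<longlonglongrightarrow> 0" by real_asymp
    qed auto
    with False show ?thesis by simp
  qed
  from tendsto_of_real[OF this, where 'a = complex]
  show "(\<lambda>m::nat. complex_of_real (exp (- real m * exp (real m * (c - q x))))) \<longlonglongrightarrow> indicator {c<..} (q x)"
    by (simp add: indicator_def of_bool_def if_distrib cong: if_cong)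
qed (auto simp: norm_exp_eq_Re)

lemma weak_null_const: "weak_null (\<lambda>x. c)"
  using weak_null_cmult[OF weak_null_power_exp[of 0 0], of c] by simp

text \<open>Dynkin's argument: the open half-lines form an intersection-stable generator.
  Complements are handled by linearity, as constants are weakly null, and disjoint unions by bounded
  limits of partial sums.\<close>

lemma weak_null_indicator:
  assumes "S \<in> sets borel"
  shows "weak_null (\<lambda>x. indicator S (q x))"
proof -
  let ?G = "range (\<lambda>c::real. {c<..})"
  have "Int_stable ?G"
    by (rule Int_stableI) (auto simp: image_iff intro: exI[of _ "max _ _"])
  moreover have "?G \<subseteq> Pow UNIV" by simp
  moreover have "S \<in> sigma_sets UNIV ?G"
    using assms by (simp add: borel_Ioi)
  ultimately show ?thesis
  proof (induction rule: sigma_sets_induct_disjoint)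
    case (basic A)
    then show ?case using weak_null_greaterThan by auto
  next
    case empty
    then show ?case by (simp add: weak_null_0)
  next
    case (compl A)
    have "weak_null (\<lambda>x. 1 + (-1) * indicator A (q x))"
      by (intro weak_null_add weak_null_cmult weak_null_const compl.IH)
    moreover have "indicator (UNIV - A) (q x) = 1 + (-1) * (indicator A (q x) :: complex)" for x
      by (simp add: indicator_def)
    ultimately show ?case by simp
  next
    case (union A)
    have [measurable]: "A i \<in> sets borel" for i using union(2) by (auto simp: borel_Ioi)
    have [measurable]: "(\<Union>i. A i) \<in> sets borel" by measurable
    show ?case
    proof (rule weak_null_bounded_lim)
      show "weak_null (\<lambda>x. \<Sum>i<m. indicator (A i) (q x))" for m :: nat
        by (intro weak_null_sum union.IH)
      have *: "(\<Sum>i<m. indicator (A i) y) = (indicator (\<Union>i<m. A i) y :: complex)" for m :: nat and y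
        by (rule indicator_UN_disjoint[symmetric])
          (use union(1) in \<open>auto simp: disjoint_family_on_def\<close>)
      show "(\<lambda>m. \<Sum>i<m. indicator (A i) (q x)) \<longlonglongrightarrow> (indicator (\<Union>i. A i) (q x) :: complex)" for x
        unfolding * by (rule LIMSEQ_indicator_UN)
      show "cmod (\<Sum>i<m. indicator (A i) (q x)) \<le> 1" for m :: nat and x
        unfolding * by (simp add: indicator_def)
    qed measurable
  qed
qed

text \<open>With \<open>\<mu>\<close> the image under \<open>q\<close> of the measure with density
  \<open>w\<close>, the integrability hypothesis says that \<open>g\<close> is
  \<open>\<mu>\<close>-integrable. Induction over integrable functions then leads from indicators to
  \<open>g\<close>.\<close>

theorem weak_null_compose:
  assumes [measurable]: "g \<in> borel_measurable borel"
    and int: "integrable M (\<lambda>x. w x * cmod (g (q x)))"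
  shows "weak_null (\<lambda>x. g (q x))"
proof -
  define \<mu> where "\<mu> = distr (density M (\<lambda>x. ennreal (w x))) borel q"
  have sets_\<mu> [measurable_cong]: "sets \<mu> = sets borel" and space_\<mu>: "space \<mu> = UNIV"
    by (simp_all add: \<mu>_def)
  have int_iff: "integrable \<mu> f \<longleftrightarrow> integrable M (\<lambda>x. w x *\<^sub>R f (q x))"
    if [measurable]: "f \<in> borel_measurable borel" for f :: "real \<Rightarrow> complex"
    unfolding \<mu>_def by (simp add: integrable_distr_eq integrable_density AE_w_nonneg)
  have "integrable \<mu> g"
    unfolding int_iff[OF assms(1)]
    by (rule Bochner_Integration.integrable_bound[OF int]) auto
  then show ?thesis
  proof (induction rule: integrable_induct)
    case (base A c)
    then have "weak_null (\<lambda>x. indicator A (q x))"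
      by (intro weak_null_indicator) (simp add: sets_\<mu>)
    from weak_null_cmult[OF this, of c] show ?case
      by (rule back_subst[where P = weak_null]) (auto simp: indicator_def fun_eq_iff)
  next
    case (add f g)
    then show ?case by (intro weak_null_add)
  next
    case (lim f s)
    have [measurable]: "f \<in> borel_measurable borel"
      using borel_measurable_integrable[OF \<open>integrable \<mu> f\<close>] by (simp cong: measurable_cong_sets)
    \<comment> \<open>The factor 2 is that of the bound
      \<open>norm (s i x) \<le> 2 * norm (f x)\<close> supplied by the induction rule.\<close>
    have "integrable M (\<lambda>x. 2 * norm (w x *\<^sub>R f (q x)))"
      using \<open>integrable \<mu> f\<close> by (intro integrable_mult_right integrable_norm) (simp add: int_iff)
    then have "integrable M (\<lambda>x. w x * (2 * cmod (f (q x))))"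
      by (rule integrable_cong_AE_imp) (use AE_w_nonneg in \<open>auto elim!: eventually_mono\<close>)
    from weak_null_lim[where \<psi> = "\<lambda>i x. s i (q x)", OF _ _ _ _ this] show ?case
      using lim by (simp add: space_\<mu>)
  qed
qed

end

section \<open>Gaussian integrals\<close>

lemma
  fixes f :: "real \<Rightarrow> real" and g :: "real \<Rightarrow> real"
  assumes f: "integrable lborel f" and g: "integrable lborel g"
  shows integrable_lborel_times: "integrable lborel (\<lambda>x. f (fst x) * g (snd x))"
    and integral_lborel_times:
      "(LINT x|lborel. f (fst x) * g (snd x)) = (LINT x|lborel. f x) * (LINT x|lborel. g x)"
proof -
  have [measurable]: "f \<in> borel_measurable borel" "g \<in> borel_measurable borel"
    using f g by auto
  have i: "integrable (lborel \<Otimes>\<^sub>M lborel) (\<lambda>x. f (fst x) * g (snd x))"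
  proof (rule lborel_pair.Fubini_integrable)
    show "integrable lborel (\<lambda>x. LINT y|lborel. norm (f (fst (x, y)) * g (snd (x, y))))"
      using f by (simp add: abs_mult)
  qed (use g in auto)
  then show "integrable lborel (\<lambda>x. f (fst x) * g (snd x))"
    by (simp add: lborel_prod)
  show "(LINT x|lborel. f (fst x) * g (snd x)) = (LINT x|lborel. f x) * (LINT x|lborel. g x)"
    using lborel_pair.integral_fst'[OF i] by (simp add: lborel_prod)
qed

lemma norm_prod_square: "(norm (x :: real \<times> real))\<^sup>2 = (fst x)\<^sup>2 + (snd x)\<^sup>2"
  by (simp add: norm_prod_def)

lemma has_bochner_integral_gaussian:
  fixes c :: real
  assumes "0 < c"
  shows "has_bochner_integral lborel (\<lambda>x. exp (- c * x\<^sup>2)) (sqrt (pi / c))"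
proof -
  \<comment> \<open>Variance \<open>1 / (2 * c)\<close> makes the normal density proportional to the
    given Gaussian.\<close>
  define s where "s = 1 / sqrt (2 * c)"
  have s: "s\<^sup>2 = 1 / (2 * c)" using assms by (simp add: s_def power_divide)
  have "has_bochner_integral lborel (normal_density 0 s) 1"
    using assms by (auto simp: has_bochner_integral_iff s_def)
  then have "has_bochner_integral lborel (\<lambda>x. sqrt (pi / c) * normal_density 0 s x) (sqrt (pi / c) * 1)"
    by (rule has_bochner_integral_mult_right)
  then show ?thesis
    using assms by (simp add: normal_density_def s mult.commute)
qed

lemma has_bochner_integral_gaussian_plane:
  fixes c :: real
  assumes "0 < c"
  shows "has_bochner_integral lborel (\<lambda>x :: real \<times> real. exp (- c * (norm x)\<^sup>2)) (pi / c)"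
proof -
  have "exp (- c * (norm x)\<^sup>2) = exp (- c * (fst x)\<^sup>2) * exp (- c * (snd x)\<^sup>2)" for x :: "real \<times> real"
    by (simp add: norm_prod_square mult_exp_exp algebra_simps)
  then show ?thesis
    using has_bochner_integral_gaussian[OF assms] assms
      integrable_lborel_times[of "\<lambda>x. exp (- c * x\<^sup>2)" "\<lambda>x. exp (- c * x\<^sup>2)"]
      integral_lborel_times[of "\<lambda>x. exp (- c * x\<^sup>2)" "\<lambda>x. exp (- c * x\<^sup>2)"]
    by (simp add: has_bochner_integral_iff)
qed

lemma nn_integral_gaussian_plane:
  fixes c :: real
  assumes "0 < c"
  shows "(\<integral>\<^sup>+x. ennreal (exp (- c * (norm (x :: real \<times> real))\<^sup>2)) \<partial>lborel) = ennreal (pi / c)"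
  using has_bochner_integral_gaussian_plane[OF assms]
  by (subst nn_integral_eq_integral) (auto simp: has_bochner_integral_iff)

text \<open>The standard even half-line moment after the substitution by
  \<open>c = 1 / (2 * sqrt \<xi>)\<close>; the factor \<open>(4 * \<xi>) ^ n\<close> undoes
  \<open>c ^ (2 * n)\<close>. The quotient of factorials is the one that \<open>omega\<close>
  normalises away.\<close>

lemma has_bochner_integral_half_gaussian_moment:
  fixes \<xi> :: real
  assumes "0 < \<xi>"
  shows "has_bochner_integral lborel
    (\<lambda>x. indicator {0<..} x * (x ^ (2 * n) * exp (- x\<^sup>2 / (4 * \<xi>))))
    (sqrt (pi * \<xi>) * (fact (2 * n) / fact n) * \<xi> ^ n)"
proof -
  define c where "c = 1 / (2 * sqrt \<xi>)"
  have four: "(4 :: real) ^ n = 2 ^ (2 * n)" by (simp add: power_mult)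
  have c: "0 < c" "c\<^sup>2 = 1 / (4 * \<xi>)"
    using assms by (simp_all add: c_def power_divide power_mult_distrib)
  have "has_bochner_integral lborel
      (\<lambda>x. (4 * \<xi>) ^ n * (indicator {0..} (0 + c * x) *\<^sub>R (exp (- (0 + c * x)\<^sup>2) * (0 + c * x) ^ (2 * n))))
      ((4 * \<xi>) ^ n * (sqrt pi / 2 * (fact (2 * n) / (2 ^ (2 * n) * fact n)) /\<^sub>R \<bar>c\<bar>))"
    using gaussian_moment_even_pos[of n] c(1)
    by (intro has_bochner_integral_mult_right) (subst (asm) lborel_has_bochner_integral_real_affine_iff[of c _ _ 0], auto)
  also have "(4 * \<xi>) ^ n * (sqrt pi / 2 * (fact (2 * n) / (2 ^ (2 * n) * fact n)) /\<^sub>R \<bar>c\<bar>) =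
      sqrt (pi * \<xi>) * (fact (2 * n) / fact n) * \<xi> ^ n"
    using assms four by (simp add: c_def power_mult_distrib real_sqrt_mult field_simps)
  finally show ?thesis
  proof (rule has_bochner_integral_cong_AE[THEN iffD1, rotated -1])
    \<comment> \<open>The standard moment lives on the closed half-line, which differs by the null
      set of the origin.\<close>
    have "AE x in lborel. x \<noteq> (0::real)" by (rule AE_lborel_singleton)
    then show "AE x in lborel. (4 * \<xi>) ^ n * (indicator {0..} (0 + c * x) *\<^sub>R (exp (- (0 + c * x)\<^sup>2) * (0 + c * x) ^ (2 * n)))
        = indicator {0<..} x * (x ^ (2 * n) * exp (- x\<^sup>2 / (4 * \<xi>)))"
    proof eventually_elim
      case (elim x)
      have "(4 * \<xi>) ^ n * (c * x) ^ (2 * n) = x ^ (2 * n)"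
        using assms c by (simp add: power_mult power_mult_distrib power_divide)
      moreover have "(c * x)\<^sup>2 = x\<^sup>2 / (4 * \<xi>)"
        using c by (simp add: power_mult_distrib)
      ultimately show ?case
        using elim c(1) by (auto simp: indicator_def zero_le_mult_iff mult.left_commute mult.commute)
    qed
  qed auto
qed

section \<open>The integrated heat kernel\<close>

text \<open>Twice the heat kernel of the plane at time \<open>\<xi>\<close>, the 2 coming from the
  source term of the equation. The cutoff in \<open>\<xi>\<close> is built in so that all time
  integrals run over the real line.\<close>

definition kern :: "real \<Rightarrow> real \<times> real \<Rightarrow> real \<Rightarrow> real" where
  "kern T x \<xi> = indicator {0<..<T} \<xi> * (exp (- (norm x)\<^sup>2 / (4 * \<xi>)) / (2 * pi * \<xi>))"

text \<open>The common majorant \<open>E\<close> of the opening comment. For \<open>0 < T\<close>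
  the integral diverges at \<open>x = 0\<close> and has the default value 0 there.\<close>

definition kern_integral :: "real \<Rightarrow> real \<times> real \<Rightarrow> real" where
  "kern_integral T x = (LINT \<xi>|lborel. kern T x \<xi>)"

lemma kern_nonneg: "0 \<le> kern T x \<xi>"
  by (simp add: kern_def indicator_def)

lemma kern_integral_nonneg: "0 \<le> kern_integral T x"
  by (simp add: kern_integral_def kern_nonneg)

lemma kern_measurable [measurable (raw)]:
  assumes [measurable]: "f \<in> borel_measurable M" "g \<in> borel_measurable M"
  shows "(\<lambda>p. kern T (f p) (g p)) \<in> borel_measurable M"
  unfolding kern_def by measurable

lemma kern_integral_measurable [measurable]: "kern_integral T \<in> borel_measurable borel"
  unfolding kern_integral_def [abs_def] by measurable

text \<open>For \<open>\<xi>\<close> in the interval the weight only lowers the Gaussian rate to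
  \<open>1 / (4 * \<xi>) - a\<close>, still positive by the hypothesis.\<close>

lemma nn_integral_kern_gaussian:
  assumes "4 * \<xi> * a < 1"
  shows "(\<integral>\<^sup>+x. ennreal (kern T x \<xi> * exp (a * (norm x)\<^sup>2)) \<partial>lborel) =
    ennreal (indicator {0<..<T} \<xi> * (2 / (1 - 4 * \<xi> * a)))"
proof (cases "\<xi> \<in> {0<..<T}")
  case True
  have c: "0 < 1 / (4 * \<xi>) - a" using True assms by (simp add: field_simps)
  have "(\<integral>\<^sup>+x. ennreal (kern T x \<xi> * exp (a * (norm x)\<^sup>2)) \<partial>lborel) =
      (\<integral>\<^sup>+x. ennreal (1 / (2 * pi * \<xi>)) * ennreal (exp (- (1 / (4 * \<xi>) - a) * (norm (x :: real \<times> real))\<^sup>2)) \<partial>lborel)"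
    using True
    by (intro nn_integral_cong)
      (simp add: kern_def mult_exp_exp left_diff_distrib flip: ennreal_mult')
  also have "\<dots> = ennreal (1 / (2 * pi * \<xi>)) * ennreal (pi / (1 / (4 * \<xi>) - a))"
    by (subst nn_integral_cmult) (simp_all only: nn_integral_gaussian_plane[OF c], measurable)
  also have "\<dots> = ennreal (2 / (1 - 4 * \<xi> * a))"
    using True c assms by (simp add: field_simps flip: ennreal_mult')
  finally show ?thesis using True by simp
qed (simp add: kern_def)

text \<open>The rate \<open>1 / (8 * T)\<close> is half the critical \<open>1 / (4 * T)\<close>.
  Hence \<open>4 * \<xi> * a \<le> 1 / 2\<close> for all \<open>\<xi> < T\<close>, and the inner
  integrals stay below 4.\<close>

lemma integrable_kern_exp:
  assumes "0 < T"
  shows "integrable (lborel \<Otimes>\<^sub>M lborel) (\<lambda>(x, \<xi>). kern T x \<xi> * exp (1 / (8 * T) * (norm x)\<^sup>2))"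
proof (rule integrableI_nonneg)
  have "(\<integral>\<^sup>+p. ennreal (case p of (x, \<xi>) \<Rightarrow> kern T x \<xi> * exp (1 / (8 * T) * (norm x)\<^sup>2)) \<partial>(lborel \<Otimes>\<^sub>M lborel)) =
      (\<integral>\<^sup>+\<xi>. \<integral>\<^sup>+x. ennreal (kern T x \<xi> * exp (1 / (8 * T) * (norm x)\<^sup>2)) \<partial>lborel \<partial>lborel)"
    by (subst lborel_pair.nn_integral_snd[symmetric]) auto
  also have "\<dots> \<le> (\<integral>\<^sup>+\<xi>. 4 * indicator {0<..<T} \<xi> \<partial>lborel)"
  proof (rule nn_integral_mono)
    fix \<xi> :: real
    show "(\<integral>\<^sup>+x. ennreal (kern T x \<xi> * exp (1 / (8 * T) * (norm x)\<^sup>2)) \<partial>lborel) \<le> 4 * indicator {0<..<T} \<xi>"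
    proof (cases "\<xi> \<in> {0<..<T}")
      case True
      then have "4 * \<xi> * (1 / (8 * T)) \<le> 1 / 2" using assms by (simp add: field_simps)
      then have "2 / (1 - 4 * \<xi> * (1 / (8 * T))) \<le> 2 / (1 / 2)" by (intro frac_le) auto
      from ennreal_leI[OF this] show ?thesis
        using True \<open>4 * \<xi> * (1 / (8 * T)) \<le> 1 / 2\<close>
        by (subst nn_integral_kern_gaussian) auto
    qed (simp add: kern_def)
  qed
  also have "\<dots> < \<infinity>"
    using assms by (simp add: nn_integral_cmult ennreal_mult_less_top)
  finally show "(\<integral>\<^sup>+p. ennreal (case p of (x, \<xi>) \<Rightarrow> kern T x \<xi> * exp (1 / (8 * T) * (norm x)\<^sup>2)) \<partial>(lborel \<Otimes>\<^sub>M lborel)) < \<infinity>" .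
qed (auto simp: kern_nonneg)

lemma integrable_kern_integral_exp:
  assumes "0 < T"
  shows "integrable lborel (\<lambda>x. kern_integral T x * exp (1 / (8 * T) * (norm x)\<^sup>2))"
  using lborel_pair.integrable_fst[OF integrable_kern_exp[OF assms]]
  by (simp add: kern_integral_def)

section \<open>Square integrability of the integrated kernel\<close>

lemma nn_integral_inverse_sqrt:
  assumes "0 < (T :: real)"
  shows "(\<integral>\<^sup>+\<xi>. ennreal (indicator {0<..<T} \<xi> / sqrt \<xi>) \<partial>lborel) < \<infinity>"
proof -
  have "(\<lambda>\<xi>. \<xi> powr (- 1 / 2)) absolutely_integrable_on {0..T}"
    using integrable_on_powr_from_0[of "- 1 / 2" T] assms
    by (intro nonnegative_absolutely_integrable_1) auto
  then have "integrable lebesgue (\<lambda>\<xi>. indicator {0..T} \<xi> *\<^sub>R \<xi> powr (- 1 / 2))"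
    by (simp add: set_integrable_def)
  then have "integrable lborel (\<lambda>\<xi>. indicator {0..T} \<xi> *\<^sub>R \<xi> powr (- 1 / 2))"
    by (subst (asm) integrable_completion) auto
  then have "(\<integral>\<^sup>+\<xi>. ennreal (norm (indicator {0..T} \<xi> *\<^sub>R \<xi> powr (- 1 / 2))) \<partial>lborel) < \<infinity>"
    by (simp add: integrable_iff_bounded)
  moreover have "(\<integral>\<^sup>+\<xi>. ennreal (indicator {0<..<T} \<xi> / sqrt \<xi>) \<partial>lborel) \<le>
      (\<integral>\<^sup>+\<xi>. ennreal (norm (indicator {0..T} \<xi> *\<^sub>R \<xi> powr (- 1 / 2))) \<partial>lborel)"
    by (intro nn_integral_mono ennreal_leI)
      (auto simp: indicator_def powr_minus_divide powr_half_sqrt)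
  ultimately show ?thesis by (rule order_le_less_trans[rotated])
qed

text \<open>The product is a Gaussian of total mass \<open>1 / (pi * (\<xi> + \<eta>))\<close>. The
  inequality of arithmetic and geometric means separates the variables into two factors integrable
  over the interval.\<close>

lemma nn_integral_kern_mult_kern:
  "(\<integral>\<^sup>+x. ennreal (kern T x \<xi>) * ennreal (kern T x \<eta>) \<partial>lborel) \<le>
    ennreal (indicator {0<..<T} \<xi> / sqrt \<xi>) * ennreal (indicator {0<..<T} \<eta> / sqrt \<eta>)"
proof (cases "\<xi> \<in> {0<..<T} \<and> \<eta> \<in> {0<..<T}")
  case True
  define c where "c = 1 / (4 * \<xi>) + 1 / (4 * \<eta>)"
  have c: "0 < c" using True by (simp add: c_def add_pos_pos)
  have "(\<integral>\<^sup>+x. ennreal (kern T x \<xi>) * ennreal (kern T x \<eta>) \<partial>lborel) =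
      (\<integral>\<^sup>+x. ennreal (1 / (4 * pi\<^sup>2 * \<xi> * \<eta>)) * ennreal (exp (- c * (norm (x :: real \<times> real))\<^sup>2)) \<partial>lborel)"
  proof (rule nn_integral_cong)
    fix x :: "real \<times> real"
    have "exp (- (norm x)\<^sup>2 / (4 * \<xi>)) * exp (- (norm x)\<^sup>2 / (4 * \<eta>)) = exp (- c * (norm x)\<^sup>2)"
      unfolding mult_exp_exp by (simp add: c_def algebra_simps)
    then have "kern T x \<xi> * kern T x \<eta> = 1 / (4 * pi\<^sup>2 * \<xi> * \<eta>) * exp (- c * (norm x)\<^sup>2)"
      using True by (simp add: kern_def power2_eq_square)
    then show "ennreal (kern T x \<xi>) * ennreal (kern T x \<eta>) =
        ennreal (1 / (4 * pi\<^sup>2 * \<xi> * \<eta>)) * ennreal (exp (- c * (norm x)\<^sup>2))"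
      by (simp add: kern_nonneg flip: ennreal_mult' ennreal_mult'')
  qed
  also have "\<dots> = ennreal (1 / (4 * pi\<^sup>2 * \<xi> * \<eta>)) * ennreal (pi / c)"
    by (subst nn_integral_cmult) (simp_all only: nn_integral_gaussian_plane[OF c], measurable)
  also have "\<dots> = ennreal (1 / (pi * (\<xi> + \<eta>)))"
    using True c by (simp add: c_def power2_eq_square field_simps flip: ennreal_mult')
  also have "\<dots> \<le> ennreal (1 / sqrt \<xi> * (1 / sqrt \<eta>))"
  proof (rule ennreal_leI)
    have "0 \<le> \<xi> * \<eta>" using True by simp
    have "sqrt \<xi> * sqrt \<eta> \<le> (\<xi> + \<eta>) / 2"
      using arith_geo_mean_sqrt[of \<xi> \<eta>] True by (simp add: real_sqrt_mult)
    also have "\<dots> \<le> pi * (\<xi> + \<eta>)"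
      using True pi_gt3 by (intro order_trans[OF _ mult_right_mono[of 1 pi "\<xi> + \<eta>"]]) auto
    finally show "1 / (pi * (\<xi> + \<eta>)) \<le> 1 / sqrt \<xi> * (1 / sqrt \<eta>)"
      using True by (simp add: divide_le_eq frac_le)
  qed
  finally show ?thesis using True by (simp flip: ennreal_mult')
qed (auto simp: kern_def)

text \<open>Where the integral diverges, the left side is the default value 0, so the bound holds at
  every point.\<close>

lemma kern_integral_le_nn_integral: "ennreal (kern_integral T x) \<le> (\<integral>\<^sup>+\<xi>. ennreal (kern T x \<xi>) \<partial>lborel)"
proof (cases "integrable lborel (kern T x)")
  case True
  then show ?thesis
    using nn_integral_eq_integral[OF True] by (simp add: kern_integral_def kern_nonneg)
qed (simp add: kern_integral_def not_integrable_integral_eq)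

text \<open>The square is written as a double integral in time; Tonelli moves the integration over
  the plane inside, where \<open>nn_integral_kern_mult_kern\<close> applies.\<close>

lemma integrable_kern_integral_square:
  assumes "0 < T"
  shows "integrable lborel (\<lambda>x. (kern_integral T x)\<^sup>2)"
proof (rule integrableI_nonneg)
  let ?s = "\<lambda>\<xi>. ennreal (indicator {0<..<T} \<xi> / sqrt \<xi>)"
  have "(\<integral>\<^sup>+x. ennreal ((kern_integral T x)\<^sup>2) \<partial>lborel) \<le>
      (\<integral>\<^sup>+x. (\<integral>\<^sup>+\<xi>. \<integral>\<^sup>+\<eta>. ennreal (kern T x \<xi>) * ennreal (kern T x \<eta>) \<partial>lborel \<partial>lborel) \<partial>lborel)"
  proof (rule nn_integral_mono)
    fix x
    have "ennreal ((kern_integral T x)\<^sup>2) = ennreal (kern_integral T x) * ennreal (kern_integral T x)"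
      by (simp add: power2_eq_square kern_integral_nonneg ennreal_mult')
    also have "\<dots> \<le> (\<integral>\<^sup>+\<xi>. ennreal (kern T x \<xi>) \<partial>lborel) * (\<integral>\<^sup>+\<xi>. ennreal (kern T x \<xi>) \<partial>lborel)"
      by (intro mult_mono kern_integral_le_nn_integral) auto
    also have "\<dots> = (\<integral>\<^sup>+\<xi>. \<integral>\<^sup>+\<eta>. ennreal (kern T x \<xi>) * ennreal (kern T x \<eta>) \<partial>lborel \<partial>lborel)"
      by (simp add: nn_integral_cmult nn_integral_multc)
    finally show "ennreal ((kern_integral T x)\<^sup>2) \<le>
      (\<integral>\<^sup>+\<xi>. \<integral>\<^sup>+\<eta>. ennreal (kern T x \<xi>) * ennreal (kern T x \<eta>) \<partial>lborel \<partial>lborel)" .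
  qed
  also have "\<dots> = (\<integral>\<^sup>+\<xi>. \<integral>\<^sup>+x. \<integral>\<^sup>+\<eta>. ennreal (kern T x \<xi>) * ennreal (kern T x \<eta>) \<partial>lborel \<partial>lborel \<partial>lborel)"
    by (rule lborel_pair.Fubini'[symmetric]) measurable
  also have "\<dots> = (\<integral>\<^sup>+\<xi>. \<integral>\<^sup>+\<eta>. \<integral>\<^sup>+x. ennreal (kern T x \<xi>) * ennreal (kern T x \<eta>) \<partial>lborel \<partial>lborel \<partial>lborel)"
    by (intro nn_integral_cong lborel_pair.Fubini'[symmetric]) measurable
  also have "\<dots> \<le> (\<integral>\<^sup>+\<xi>. \<integral>\<^sup>+\<eta>. ?s \<xi> * ?s \<eta> \<partial>lborel \<partial>lborel)"
    by (intro nn_integral_mono nn_integral_kern_mult_kern)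
  also have "\<dots> = (\<integral>\<^sup>+\<xi>. ?s \<xi> \<partial>lborel) * (\<integral>\<^sup>+\<xi>. ?s \<xi> \<partial>lborel)"
    by (simp add: nn_integral_cmult nn_integral_multc)
  also have "\<dots> < \<infinity>"
    using nn_integral_inverse_sqrt[OF assms] by (simp add: ennreal_mult_less_top)
  finally show "(\<integral>\<^sup>+x. ennreal ((kern_integral T x)\<^sup>2) \<partial>lborel) < \<infinity>" .
qed auto

text \<open>Away from the origin \<open>exp (- q / (4 * \<xi>)) \<le> 4 * \<xi> / q\<close> cancels
  the singularity \<open>1 / \<xi>\<close>, so the kernel is bounded on a bounded interval.\<close>

lemma integrable_kern:
  assumes "x \<noteq> 0"
  shows "integrable lborel (kern T x)"
proof (rule Bochner_Integration.integrable_bound)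
  define q where "q = (norm x)\<^sup>2"
  have q: "0 < q" using assms by (simp add: q_def)
  show "integrable lborel (\<lambda>\<xi>. 2 / (pi * q) * indicator {0<..<T} \<xi>)"
    by (cases "0 \<le> T") auto
  show "AE \<xi> in lborel. norm (kern T x \<xi>) \<le> norm (2 / (pi * q) * indicator {0<..<T} \<xi>)"
  proof (rule AE_I2)
    fix \<xi> :: real
    show "norm (kern T x \<xi>) \<le> norm (2 / (pi * q) * indicator {0<..<T} \<xi>)"
    proof (cases "\<xi> \<in> {0<..<T}")
      case True
      have "q / (4 * \<xi>) \<le> exp (q / (4 * \<xi>))"
        using exp_ge_add_one_self[of "q / (4 * \<xi>)"] by linarith
      then have "exp (- q / (4 * \<xi>)) \<le> 4 * \<xi> / q"
        using True q by (simp add: exp_minus field_simps)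
      then have "exp (- q / (4 * \<xi>)) / (2 * pi * \<xi>) \<le> 4 * \<xi> / q / (2 * pi * \<xi>)"
        using True by (intro divide_right_mono) auto
      also have "\<dots> = 2 / (pi * q)" using True by simp
      finally show ?thesis using True q by (simp add: kern_def flip: q_def)
    qed (simp add: kern_def)
  qed
qed measurable

text \<open>On \<open>T z / (1 + z) \<le> \<xi> < T\<close> the exponent \<open>T z / \<xi>\<close>, where \<open>z = |x|\<^sup>2 / 4 T\<close>, is at most \<open>z + 1\<close>.\<close>

lemma exp_ln_le_kern_integral:
  assumes "x \<noteq> 0" "0 < T"
  shows "1 / (2 * pi) * exp (- (norm x)\<^sup>2 / (4 * T)) * ln (1 + 4 * T / (norm x)\<^sup>2) \<le> exp 1 * kern_integral T x"
proof -
  define z where "z = (norm x)\<^sup>2 / (4 * T)"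
  have z: "0 < z" using assms by (simp add: z_def)
  define s where "s = T * z / (1 + z)"
  have s: "0 < s" "s < T" using z assms by (auto simp: s_def field_simps)
  \<comment> \<open>A minorant of \<open>kern T x\<close> on \<open>{s..T}\<close> with a logarithm
    as antiderivative. Since \<open>T / s = 1 + 1 / z\<close>, it produces the logarithm of the
    claim; the loss of 1 in the exponent is the factor \<open>exp 1\<close>.\<close>
  let ?f = "\<lambda>\<xi>. exp (- (z + 1)) / (2 * pi) * (1 / \<xi>)"
  have "has_bochner_integral lborel (\<lambda>\<xi>. ?f \<xi> * indicator {s..T} \<xi>)
      (exp (- (z + 1)) / (2 * pi) * ln T - exp (- (z + 1)) / (2 * pi) * ln s)"
  proof (rule has_bochner_integral_FTC_Icc_nonneg)
    show "DERIV (\<lambda>\<xi>. exp (- (z + 1)) / (2 * pi) * ln \<xi>) \<xi> :> ?f \<xi>" if "\<xi> \<in> {s..T}" for \<xi>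
      using that s by (auto intro!: derivative_eq_intros)
  qed (use s in auto)
  then have f: "integrable lborel (\<lambda>\<xi>. ?f \<xi> * indicator {s..T} \<xi>)"
    and "(LINT \<xi>|lborel. ?f \<xi> * indicator {s..T} \<xi>) = exp (- (z + 1)) / (2 * pi) * (ln T - ln s)"
    by (auto simp: has_bochner_integral_iff right_diff_distrib)
  moreover have "ln T - ln s = ln (1 + 1 / z)"
  proof -
    have "ln T - ln s = ln (T / s)" using s by (simp add: ln_div)
    also have "T / s = 1 + 1 / z" using z assms by (simp add: s_def field_simps)
    finally show ?thesis .
  qed
  ultimately have "exp (- (z + 1)) / (2 * pi) * ln (1 + 1 / z) = (LINT \<xi>|lborel. ?f \<xi> * indicator {s..T} \<xi>)"
    by simp
  also have "\<dots> \<le> kern_integral T x"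
    unfolding kern_integral_def
  proof (rule integral_mono_AE[OF f integrable_kern[OF assms(1)]])
    have "AE \<xi> in lborel. \<xi> \<noteq> T" by (rule AE_lborel_singleton)
    then show "AE \<xi> in lborel. ?f \<xi> * indicator {s..T} \<xi> \<le> kern T x \<xi>"
    proof eventually_elim
      case (elim \<xi>)
      show ?case
      proof (cases "\<xi> \<in> {s..T}")
        case True
        with elim s have \<xi>: "0 < \<xi>" "\<xi> < T" "s \<le> \<xi>" by auto
        have "z * T / \<xi> \<le> z + 1"
          using \<xi> z by (simp add: s_def field_simps)
        moreover have "(norm x)\<^sup>2 / (4 * \<xi>) = z * T / \<xi>"
          using \<xi> assms by (simp add: z_def)
        ultimately have "exp (- (z + 1)) \<le> exp (- (norm x)\<^sup>2 / (4 * \<xi>))"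
          by simp
        then have "exp (- (z + 1)) / (2 * pi * \<xi>) \<le> exp (- (norm x)\<^sup>2 / (4 * \<xi>)) / (2 * pi * \<xi>)"
          using \<xi> by (intro divide_right_mono) auto
        then show ?thesis using True \<xi> by (simp add: kern_def)
      qed (simp add: kern_nonneg)
    qed
  qed
  finally have "exp 1 * (exp (- (z + 1)) / (2 * pi) * ln (1 + 1 / z)) \<le> exp 1 * kern_integral T x"
    by (intro mult_left_mono) auto
  moreover have "exp 1 * exp (- (z + 1)) = exp (- z)" by (simp add: mult_exp_exp)
  then have "exp 1 * (exp (- (z + 1)) / (2 * pi) * ln (1 + 1 / z)) = 1 / (2 * pi) * exp (- z) * ln (1 + 1 / z)"
    by (simp only: times_divide_eq_left times_divide_eq_right mult_1_left flip: mult.assoc)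
  ultimately have "1 / (2 * pi) * exp (- z) * ln (1 + 1 / z) \<le> exp 1 * kern_integral T x"
    by (simp only:)
  then show ?thesis by (simp add: z_def)
qed

section \<open>Moments of radial functions\<close>

lemma nn_integral_lborel_scaleR:
  fixes f :: "'a::euclidean_space \<Rightarrow> ennreal"
  assumes [measurable]: "f \<in> borel_measurable borel" and "0 < r"
  shows "(\<integral>\<^sup>+x. f x \<partial>lborel) = ennreal (r ^ DIM('a)) * (\<integral>\<^sup>+x. f (r *\<^sub>R x) \<partial>lborel)"
  using assms(2)
  by (subst lborel_affine[of r 0])
    (simp_all add: nn_integral_density nn_integral_distr nn_integral_cmult ennreal_power)

lemma cball_measurable [measurable]: "cball c r \<in> sets borel"
  by (intro borel_closed closed_cball)

text \<open>Under dilation by \<open>r\<close> the volume contributes \<open>r ^ DIM('a)\<close> and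
  the integrand \<open>r ^ d\<close>.\<close>

lemma nn_integral_homogeneous:
  fixes p :: "'a::euclidean_space \<Rightarrow> real"
  assumes [measurable]: "p \<in> borel_measurable borel"
    and homogeneous: "\<And>r x. 0 < r \<Longrightarrow> p (r *\<^sub>R x) = r ^ d * p x"
    and "0 < r"
  shows "(\<integral>\<^sup>+x. ennreal (p x) * indicator (cball 0 r) x \<partial>lborel) =
    ennreal (r ^ (DIM('a) + d)) * (\<integral>\<^sup>+x. ennreal (p x) * indicator (cball 0 1) x \<partial>lborel)"
proof -
  have "(\<integral>\<^sup>+x. ennreal (p x) * indicator (cball 0 r) x \<partial>lborel) =
      ennreal (r ^ DIM('a)) * (\<integral>\<^sup>+x. ennreal (p (r *\<^sub>R x)) * indicator (cball 0 r) (r *\<^sub>R x) \<partial>lborel)"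
    by (rule nn_integral_lborel_scaleR) (use \<open>0 < r\<close> in measurable)
  also have "(\<integral>\<^sup>+x. ennreal (p (r *\<^sub>R x)) * indicator (cball 0 r) (r *\<^sub>R x) \<partial>lborel) =
      (\<integral>\<^sup>+x. ennreal (r ^ d) * (ennreal (p x) * indicator (cball 0 1) x) \<partial>lborel)"
    using \<open>0 < r\<close>
    by (intro nn_integral_cong)
      (auto simp: homogeneous ennreal_mult' mult.assoc indicator_def)
  also have "\<dots> = ennreal (r ^ d) * (\<integral>\<^sup>+x. ennreal (p x) * indicator (cball 0 1) x \<partial>lborel)"
    by (rule nn_integral_cmult) measurable
  finally show ?thesis
    using \<open>0 < r\<close> by (simp add: power_add ennreal_mult' mult.assoc)
qed

text \<open>By scaling, the mass of a ball is its mass at radius 1 times a power of the radius that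
  is the same for \<open>p1\<close> and \<open>p2\<close>. Weighting each density by the unit-ball
  mass of the other makes the images agree on all \<open>{..s}\<close>, hence everywhere.\<close>

lemma distr_norm_square_homogeneous:
  fixes p1 p2 :: "'a::euclidean_space \<Rightarrow> real"
  assumes [measurable]: "p1 \<in> borel_measurable borel" "p2 \<in> borel_measurable borel"
    and homogeneous: "\<And>r x. 0 < r \<Longrightarrow> p1 (r *\<^sub>R x) = r ^ d * p1 x"
      "\<And>r x. 0 < r \<Longrightarrow> p2 (r *\<^sub>R x) = r ^ d * p2 x"
    and nonneg: "0 \<le> m1" "0 \<le> m2"
    and m1: "(\<integral>\<^sup>+x. ennreal (p1 x) * indicator (cball 0 1) x \<partial>lborel) = ennreal m1"
    and m2: "(\<integral>\<^sup>+x. ennreal (p2 x) * indicator (cball 0 1) x \<partial>lborel) = ennreal m2"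
  shows "distr (density lborel (\<lambda>x. ennreal (m2 * p1 x))) borel (\<lambda>x. (norm x)\<^sup>2) =
    distr (density lborel (\<lambda>x. ennreal (m1 * p2 x))) borel (\<lambda>x. (norm x)\<^sup>2)"
    (is "?L = ?R")
proof -
  have level: "emeasure (distr (density lborel (\<lambda>x. ennreal (m * p x))) borel (\<lambda>x. (norm x)\<^sup>2)) {..s} =
      (if s \<le> 0 then 0 else ennreal (sqrt s ^ (DIM('a) + d)) * (ennreal m * ennreal m'))"
    if [measurable]: "p \<in> borel_measurable borel"
      and p: "\<And>r x. 0 < r \<Longrightarrow> p (r *\<^sub>R x) = r ^ d * p x" and "0 \<le> m"
      and m': "(\<integral>\<^sup>+x. ennreal (p x) * indicator (cball 0 1) x \<partial>lborel) = ennreal m'"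
    for p :: "'a \<Rightarrow> real" and m m' s
  proof -
    have [measurable]: "(\<lambda>x::'a. (norm x)\<^sup>2) -` {..s} \<in> sets borel"
      by (intro borel_closed closed_vimage) (auto intro!: continuous_intros)
    have "emeasure (distr (density lborel (\<lambda>x. ennreal (m * p x))) borel (\<lambda>x. (norm x)\<^sup>2)) {..s} =
        (\<integral>\<^sup>+x. ennreal (m * p x) * indicator ((\<lambda>x. (norm x)\<^sup>2) -` {..s}) x \<partial>lborel)"
      by (subst emeasure_distr) (auto simp: emeasure_density measurable_sets_borel)
    also have "\<dots> = (if s \<le> 0 then 0 else ennreal (sqrt s ^ (DIM('a) + d)) * (ennreal m * ennreal m'))"
    proof (cases "s \<le> 0")
      case True
      \<comment> \<open>For \<open>s \<le> 0\<close> the sublevel set is contained in the null set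
        \<open>{0}\<close>.\<close>
      have "AE x in lborel. x \<noteq> (0::'a)" by (rule AE_lborel_singleton)
      then have "AE x in lborel. ennreal (m * p x) * indicator ((\<lambda>x. (norm x)\<^sup>2) -` {..s}) x = 0"
      proof eventually_elim
        case (elim x)
        then have "0 < (norm x)\<^sup>2" by simp
        with True have "\<not> (norm x)\<^sup>2 \<le> s" by linarith
        then show ?case by simp
      qed
      then have "(\<integral>\<^sup>+x. ennreal (m * p x) * indicator ((\<lambda>x. (norm x)\<^sup>2) -` {..s}) x \<partial>lborel) = (\<integral>\<^sup>+x. 0 \<partial>(lborel :: 'a measure))"
        by (rule nn_integral_cong_AE)
      with True show ?thesis by simp
    next
      case False
      then have "(\<lambda>x. (norm x)\<^sup>2) -` {..s} = cball (0::'a) (sqrt s)"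
        by (auto simp: real_le_rsqrt sqrt_ge_absD)
      then have "(\<integral>\<^sup>+x. ennreal (m * p x) * indicator ((\<lambda>x. (norm x)\<^sup>2) -` {..s}) x \<partial>lborel) =
          (\<integral>\<^sup>+x. ennreal m * (ennreal (p x) * indicator (cball 0 (sqrt s)) x) \<partial>lborel)"
        using \<open>0 \<le> m\<close> by (simp add: ennreal_mult' mult.assoc)
      also have "\<dots> = ennreal m * (\<integral>\<^sup>+x. ennreal (p x) * indicator (cball 0 (sqrt s)) x \<partial>lborel)"
        by (rule nn_integral_cmult) measurable
      also have "\<dots> = ennreal m * (ennreal (sqrt s ^ (DIM('a) + d)) * ennreal m')"
        using False by (subst nn_integral_homogeneous[where d = d]) (auto simp: p m')
      finally show ?thesis using False by (simp add: mult.left_commute)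
    qed
    finally show ?thesis .
  qed
  show ?thesis
  proof (rule measure_eqI_generator_eq[where E = "range (\<lambda>s::real. {..s})" and \<Omega> = UNIV
        and A = "\<lambda>i. {..real i}"])
    show "Int_stable (range (\<lambda>s::real. {..s}))"
      by (rule Int_stableI) auto
    show "sets ?L = sigma_sets UNIV (range (\<lambda>s. {..s}))" "sets ?R = sigma_sets UNIV (range (\<lambda>s. {..s}))"
      by (simp_all add: borel_eq_atMost)
    show "emeasure ?L X = emeasure ?R X" if "X \<in> range (\<lambda>s. {..s})" for X
      using that homogeneous nonneg m1 m2 by (auto simp: level mult.commute[of "ennreal m1"])
    show "emeasure ?L {..real i} \<noteq> \<infinity>" for i
      using homogeneous nonneg m1 by (simp add: level flip: ennreal_mult')
    show "(\<Union>i. {..real i}) = UNIV"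
      by (auto intro: real_arch_simple)
  qed auto
qed

text \<open>The weight inside \<open>omega\<close>. The open quadrant is invariant under dilations,
  so the cutoff keeps the weight homogeneous of degree \<open>2 * n\<close>.\<close>

definition quadrant_weight :: "nat \<Rightarrow> real \<times> real \<Rightarrow> real" where
  "quadrant_weight n x = indicator ({0<..} \<times> {0<..}) x * fst x ^ (2 * n)"

lemma quadrant_weight_measurable [measurable]: "quadrant_weight n \<in> borel_measurable borel"
proof -
  have "{0<..} \<times> {0<..} \<in> sets (borel :: (real \<times> real) measure)"
    by (intro borel_open open_Times) auto
  moreover have "fst \<in> borel_measurable (borel :: (real \<times> real) measure)"
    by (intro borel_measurable_continuous_onI continuous_intros)
  ultimately show ?thesis unfolding quadrant_weight_def [abs_def] by measurable
qed

lemma quadrant_weight_nonneg: "0 \<le> quadrant_weight n x"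
  by (simp add: quadrant_weight_def)

lemma quadrant_weight_le: "quadrant_weight n x \<le> ((norm x)\<^sup>2) ^ n"
proof -
  have "\<bar>fst x\<bar> ^ (2 * n) \<le> norm x ^ (2 * n)"
    by (intro power_mono) (use norm_fst_le[of "fst x" "snd x"] in auto)
  then show ?thesis
    by (auto simp: quadrant_weight_def indicator_def power_mult)
qed

text \<open>
  Images under \<open>|x|\<^sup>2\<close> of measures with homogeneous densities of the same degree are proportional, so the
  quadrant moments in \<^const>\<open>omega\<close> and the moments \<open>\<integral> |x|\<^sup>2\<^sup>n k(|x|\<^sup>2) dx\<close> vanish simultaneously.
\<close>

lemma radial_moment_eq_0:
  fixes k :: "real \<Rightarrow> complex"
  assumes [measurable]: "k \<in> borel_measurable borel"
    and 0: "(LINT x|lborel. quadrant_weight n x *\<^sub>R k ((norm x)\<^sup>2)) = 0"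
  shows "(LINT x|lborel. ((norm (x :: real \<times> real))\<^sup>2) ^ n *\<^sub>R k ((norm x)\<^sup>2)) = 0"
proof -
  define p2 where "p2 x = ((norm x)\<^sup>2) ^ n" for x :: "real \<times> real"
  have [measurable]: "p2 \<in> borel_measurable borel" by (simp add: p2_def [abs_def])
  define m where "m p = enn2real (\<integral>\<^sup>+x. ennreal (p x) * indicator (cball 0 1) x \<partial>lborel)"
    for p :: "real \<times> real \<Rightarrow> real"
  have fin: "(\<integral>\<^sup>+x. ennreal (p x) * indicator (cball 0 1) x \<partial>lborel) < \<infinity>"
    if "\<And>x. p x \<le> ((norm x)\<^sup>2) ^ n" for p :: "real \<times> real \<Rightarrow> real"
  proof -
    have "(\<integral>\<^sup>+x. ennreal (p x) * indicator (cball 0 1) x \<partial>lborel) \<le>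
        (\<integral>\<^sup>+x. indicator (cball (0 :: real \<times> real) 1) x \<partial>lborel)"
    proof (rule nn_integral_mono)
      fix x :: "real \<times> real"
      show "ennreal (p x) * indicator (cball 0 1) x \<le> indicator (cball 0 1) x"
      proof (cases "norm x \<le> 1")
        case True
        then have "((norm x)\<^sup>2) ^ n \<le> 1" by (intro power_le_one) auto
        with that[of x] have "p x \<le> 1" by linarith
        then show ?thesis by (auto simp: indicator_def)
      qed (simp add: indicator_def)
    qed
    also have "\<dots> < \<infinity>" using emeasure_lborel_cball_finite[of "0 :: real \<times> real" 1] by (simp add: top_unique less_top)
    finally show ?thesis .
  qed
  have m: "(\<integral>\<^sup>+x. ennreal (p x) * indicator (cball 0 1) x \<partial>lborel) = ennreal (m p)"
    if "\<And>x. p x \<le> ((norm x)\<^sup>2) ^ n" for p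
    using fin[OF that] by (simp add: m_def)
  have [simp]: "0 \<le> m p" for p by (simp add: m_def)
  \<comment> \<open>This is the factor cancelled at the end. The weight is positive on the nonempty
    open set \<open>U\<close>, which cannot be negligible.\<close>
  have "m (quadrant_weight n) \<noteq> 0"
  proof
    assume "m (quadrant_weight n) = 0"
    then have "(\<integral>\<^sup>+x. ennreal (quadrant_weight n x) * indicator (cball 0 1) x \<partial>lborel) = 0"
      using m[OF quadrant_weight_le] by simp
    then have AE: "AE x in lborel. ennreal (quadrant_weight n x) * indicator (cball 0 1) x = 0"
      by (subst (asm) nn_integral_0_iff_AE) auto
    define U where "U = ({0<..} \<times> {0<..}) \<inter> ball (0 :: real \<times> real) 1"
    have "open U" unfolding U_def by (intro open_Int open_Times) auto
    have "AE x in lborel. x \<notin> U"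
      using AE by eventually_elim (auto simp: U_def quadrant_weight_def indicator_def)
    then have "U \<in> null_sets lborel"
      using \<open>open U\<close> by (subst AE_iff_null_sets) auto
    then have "negligible U"
      by (simp add: negligible_iff_null_sets null_sets_completionI)
    moreover have "(1/2, 1/2) \<in> U"
      by (simp add: U_def norm_Pair real_sqrt_lt_1_iff power2_eq_square)
    ultimately show False
      using open_not_negligible[OF \<open>open U\<close>] by auto
  qed
  have hom: "quadrant_weight n (r *\<^sub>R x) = r ^ (2 * n) * quadrant_weight n x" if "0 < r" for r x
    using that by (auto simp: quadrant_weight_def indicator_def power_mult_distrib mem_Times_iff zero_less_mult_iff)
  have hom2: "p2 (r *\<^sub>R x) = r ^ (2 * n) * p2 x" if "0 < r" for r x
    using that by (simp add: p2_def power_mult_distrib power_mult)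
  have int: "(LINT y|distr (density lborel (\<lambda>x. ennreal (c * p x))) borel (\<lambda>x. (norm x)\<^sup>2). k y) =
      c *\<^sub>R (LINT x|lborel. p x *\<^sub>R k ((norm x)\<^sup>2))"
    if [measurable]: "p \<in> borel_measurable borel" and "\<And>x. 0 \<le> p x" "0 \<le> c"
    for p :: "real \<times> real \<Rightarrow> real" and c
    using that by (subst integral_distr) (auto simp: integral_density simp flip: scaleR_scaleR)
  have p2_nonneg: "0 \<le> p2 x" for x by (simp add: p2_def)
  have p2: "p2 x \<le> ((norm x)\<^sup>2) ^ n" for x by (simp add: p2_def)
  have "m p2 *\<^sub>R (LINT x|lborel. quadrant_weight n x *\<^sub>R k ((norm x)\<^sup>2)) =
      m (quadrant_weight n) *\<^sub>R (LINT x|lborel. p2 x *\<^sub>R k ((norm x)\<^sup>2))"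
    using arg_cong[OF distr_norm_square_homogeneous[OF _ _ hom hom2 _ _ m[OF quadrant_weight_le] m[OF p2]],
        of "\<lambda>M. integral\<^sup>L M k"]
    by (simp add: int quadrant_weight_nonneg p2_nonneg)
  with 0 \<open>m (quadrant_weight n) \<noteq> 0\<close> show ?thesis by (simp add: p2_def)
qed

section \<open>States generated by bounded controls\<close>

text \<open>Minus the control part of the state, with \<open>v \<xi>\<close> in the place of
  \<open>u (T - \<xi>)\<close>.\<close>

definition potential :: "real \<Rightarrow> (real \<Rightarrow> complex) \<Rightarrow> real \<times> real \<Rightarrow> complex" where
  "potential T v x = (LINT \<xi>|lborel. kern T x \<xi> *\<^sub>R v \<xi>)"

lemma W_ctrl_eq_potential:
  assumes "\<And>\<xi>. \<xi> \<in> {0<..<T} \<Longrightarrow> v \<xi> = u (T - \<xi>)"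
  shows "W_ctrl u T x = - potential T v x"
proof -
  have "potential T v x = (LINT \<xi>|lborel. complex_of_real (1 / pi) * (indicator {0<..<T} \<xi> *\<^sub>R
      (complex_of_real (1 / (2 * \<xi>) * exp (- (norm x)\<^sup>2 / (4 * \<xi>))) * u (T - \<xi>))))"
    unfolding potential_def
    by (intro Bochner_Integration.integral_cong)
      (auto simp: kern_def assms indicator_def scaleR_conv_of_real)
  also have "\<dots> = complex_of_real (1 / pi) * (LINT \<xi>:{0<..<T}|lborel.
      complex_of_real (1 / (2 * \<xi>) * exp (- (norm x)\<^sup>2 / (4 * \<xi>))) * u (T - \<xi>))"
    unfolding set_lebesgue_integral_def by (rule integral_mult_right_zero)
  finally show ?thesis by (simp add: W_ctrl_def)
qed

text \<open>The control is extended by 0 before being reflected, which gives a Borel function on the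
  whole line; null sets are preserved by the reflection, and \<open>0 \<le> L\<close> covers the
  extension.\<close>

lemma reversed_control:
  assumes u: "u \<in> Linf (lborel_interval T)" "Linf_norm (lborel_interval T) u \<le> ereal L" and "0 \<le> L"
  obtains v where "v \<in> borel_measurable borel" "AE \<xi> in lborel. cmod (v \<xi>) \<le> L"
    "\<And>\<xi>. \<xi> \<in> {0<..<T} \<Longrightarrow> v \<xi> = u (T - \<xi>)"
proof -
  define u' where "u' s = indicator {0<..<T} s *\<^sub>R u s" for s
  have "u \<in> borel_measurable (lborel_interval T)"
    using u(1) by (simp add: Linf_def)
  then have [measurable]: "u' \<in> borel_measurable borel"
    unfolding u'_def [abs_def] by (subst (asm) borel_measurable_restrict_space_iff) auto
  have "AE s in lborel_interval T. ereal (cmod (u s)) \<le> ereal L"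
    using esssup_AE[where M = "lborel_interval T" and f = "\<lambda>s. ereal (cmod (u s))"]
    by eventually_elim (rule order_trans[OF _ u(2)[unfolded Linf_norm_def]])
  then have "AE s in lborel. s \<in> {0<..<T} \<longrightarrow> cmod (u s) \<le> L"
    by (subst (asm) AE_restrict_space_iff) auto
  then have "AE s in lborel. cmod (u' s) \<le> L"
    by eventually_elim (use \<open>0 \<le> L\<close> in \<open>auto simp: u'_def indicator_def\<close>)
  then have "AE \<xi> in lborel. cmod (u' (T + (- 1) * \<xi>)) \<le> L"
    by (intro AE_borel_affine) auto
  then have le: "AE \<xi> in lborel. cmod (u' (T - \<xi>)) \<le> L" by simp
  have "(\<lambda>\<xi>. u' (T - \<xi>)) \<in> borel_measurable borel" by measurable
  then show thesis
    using le by (rule that) (simp add: u'_def)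
qed

lemma AE_plane_nonzero: "AE x in lborel. x \<noteq> (0 :: real \<times> real)"
  by (rule AE_lborel_singleton)

locale bounded_control =
  fixes T L :: real and v :: "real \<Rightarrow> complex"
  assumes T_pos: "0 < T" and L_nonneg: "0 \<le> L"
    and v_measurable [measurable]: "v \<in> borel_measurable borel"
    and v_le: "AE \<xi> in lborel. cmod (v \<xi>) \<le> L"
begin

lemma potential_measurable [measurable]: "potential T v \<in> borel_measurable borel"
  unfolding potential_def [abs_def] by measurable

lemma cmod_potential_le:
  assumes "x \<noteq> 0"
  shows "cmod (potential T v x) \<le> L * kern_integral T x"
proof -
  have "cmod (potential T v x) \<le> (LINT \<xi>|lborel. L * kern T x \<xi>)"
    unfolding potential_def
  proof (rule norm_integral_dominated)
    show "integrable lborel (\<lambda>\<xi>. L * kern T x \<xi>)"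
      using integrable_kern[OF assms] by simp
    show "AE \<xi> in lborel. norm (kern T x \<xi> *\<^sub>R v \<xi>) \<le> L * kern T x \<xi>"
      using v_le by eventually_elim (simp add: kern_nonneg mult.commute mult_right_mono)
  qed measurable
  then show ?thesis by (simp add: kern_integral_def)
qed

text \<open>With the kernel unfolded, \<open>x\<close> enters only through its squared norm; this
  yields the radial profile in the main proof.\<close>

lemma potential_radial:
  "potential T v x = (LINT \<xi>|lborel. (indicator {0<..<T} \<xi> * (exp (- (norm x)\<^sup>2 / (4 * \<xi>)) / (2 * pi * \<xi>))) *\<^sub>R v \<xi>)"
  by (simp add: potential_def kern_def)

end

text \<open>Integrating the modulus in time first produces
  \<open>kern_integral T x * cmod (\<phi> x)\<close>; the time slices are integrable off the
  origin.\<close>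

lemma integrable_kern_mult:
  fixes \<phi> :: "real \<times> real \<Rightarrow> complex"
  assumes [measurable]: "\<phi> \<in> borel_measurable borel"
    and int: "integrable lborel (\<lambda>x. kern_integral T x * cmod (\<phi> x))"
  shows "integrable (lborel \<Otimes>\<^sub>M lborel) (\<lambda>(x, \<xi>). kern T x \<xi> *\<^sub>R \<phi> x)"
proof (rule lborel_pair.Fubini_integrable)
  show "integrable lborel (\<lambda>x. LINT \<xi>|lborel. norm (case (x, \<xi>) of (x, \<xi>) \<Rightarrow> kern T x \<xi> *\<^sub>R \<phi> x))"
    using int by (simp add: kern_nonneg kern_integral_def)
  show "AE x in lborel. integrable lborel (\<lambda>\<xi>. case (x, \<xi>) of (x, \<xi>) \<Rightarrow> kern T x \<xi> *\<^sub>R \<phi> x)"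
    using AE_plane_nonzero
  proof eventually_elim
    case (elim x)
    then show ?case by (simp add: integrable_kern)
  qed
qed measurable

text \<open>Fubini, justified because \<open>L\<close> times the integrable function of
  \<open>integrable_kern_mult\<close> dominates the integrand.\<close>

lemma (in bounded_control) integral_mult_potential:
  fixes \<phi> :: "real \<times> real \<Rightarrow> complex"
  assumes [measurable]: "\<phi> \<in> borel_measurable borel"
    and int: "integrable lborel (\<lambda>x. kern_integral T x * cmod (\<phi> x))"
  shows "(LINT x|lborel. \<phi> x * potential T v x) =
    (LINT \<xi>|lborel. (LINT x|lborel. kern T x \<xi> *\<^sub>R \<phi> x) * v \<xi>)"
proof -
  have 1: "integrable (lborel \<Otimes>\<^sub>M lborel) (\<lambda>(x, \<xi>). kern T x \<xi> *\<^sub>R \<phi> x)"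
    by (rule integrable_kern_mult[OF assms])
  have 2: "integrable (lborel \<Otimes>\<^sub>M lborel) (\<lambda>(x, \<xi>). kern T x \<xi> *\<^sub>R (\<phi> x * v \<xi>))"
  proof (rule Bochner_Integration.integrable_bound[OF integrable_scaleR_right[OF 1, of L]])
    have "AE p in lborel \<Otimes>\<^sub>M lborel. cmod (v (snd p)) \<le> L"
    proof (rule lborel_pair.AE_pair_measure)
      show "{p \<in> space (lborel \<Otimes>\<^sub>M lborel). cmod (v (snd p)) \<le> L} \<in> sets (lborel \<Otimes>\<^sub>M lborel)"
        by measurable
    qed (use v_le in auto)
    then show "AE p in lborel \<Otimes>\<^sub>M lborel. norm (case p of (x, \<xi>) \<Rightarrow> kern T x \<xi> *\<^sub>R (\<phi> x * v \<xi>))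
        \<le> norm (L *\<^sub>R (case p of (x, \<xi>) \<Rightarrow> kern T x \<xi> *\<^sub>R \<phi> x))"
    proof eventually_elim
      case (elim p)
      have "kern T (fst p) (snd p) * (cmod (\<phi> (fst p)) * cmod (v (snd p))) \<le>
          kern T (fst p) (snd p) * (cmod (\<phi> (fst p)) * L)"
        by (intro mult_left_mono elim) (auto simp: kern_nonneg)
      then show ?case
        using L_nonneg by (simp add: split_beta kern_nonneg norm_mult mult_ac)
    qed
  qed measurable
  have "(LINT x|lborel. \<phi> x * potential T v x) =
      (LINT x|lborel. LINT \<xi>|lborel. kern T x \<xi> *\<^sub>R (\<phi> x * v \<xi>))"
    unfolding potential_def by (simp flip: integral_mult_right_zero)
  also have "\<dots> = (LINT \<xi>|lborel. LINT x|lborel. kern T x \<xi> *\<^sub>R (\<phi> x * v \<xi>))"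
    by (rule lborel_pair.Fubini_integral[symmetric, OF 2])
  also have "\<dots> = (LINT \<xi>|lborel. (LINT x|lborel. kern T x \<xi> *\<^sub>R \<phi> x) * v \<xi>)"
    by (simp flip: integral_mult_left_zero)
  finally show ?thesis .
qed

text \<open>The Gaussian splits into half-line moments of orders \<open>2 * n\<close> and 0, whose
  two factors \<open>sqrt (pi * \<xi>)\<close> cancel against the prefactor. The remaining
  \<open>\<xi> ^ n\<close> turns spatial moments into power moments of the control.\<close>

lemma integral_quadrant_weight_kern:
  "(LINT x|lborel. quadrant_weight n x * kern T x \<xi>) =
    indicator {0<..<T} \<xi> * (fact (2 * n) / (2 * fact n) * \<xi> ^ n)"
proof (cases "\<xi> \<in> {0<..<T}")
  case True
  then have \<xi>: "0 < \<xi>" by simp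
  let ?f = "\<lambda>n x. indicator {0<..} x * (x ^ (2 * n) * exp (- x\<^sup>2 / (4 * \<xi>))) :: real"
  have "(LINT x|lborel. quadrant_weight n x * kern T x \<xi>) =
      (LINT x|lborel. 1 / (2 * pi * \<xi>) * (?f n (fst x) * ?f 0 (snd x)))"
  proof (rule Bochner_Integration.integral_cong[OF refl])
    fix x :: "real \<times> real"
    have "exp (- (norm x)\<^sup>2 / (4 * \<xi>)) = exp (- (fst x)\<^sup>2 / (4 * \<xi>)) * exp (- (snd x)\<^sup>2 / (4 * \<xi>))"
      by (simp add: norm_prod_square mult_exp_exp add_divide_distrib diff_divide_distrib)
    then show "quadrant_weight n x * kern T x \<xi> = 1 / (2 * pi * \<xi>) * (?f n (fst x) * ?f 0 (snd x))"
      using True by (simp add: quadrant_weight_def kern_def indicator_times)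
  qed
  also have "\<dots> = 1 / (2 * pi * \<xi>) * ((LINT x|lborel. ?f n x) * (LINT x|lborel. ?f 0 x))"
    using has_bochner_integral_half_gaussian_moment[OF \<xi>, of n]
      has_bochner_integral_half_gaussian_moment[OF \<xi>, of 0]
    by (subst integral_mult_right_zero, subst integral_lborel_times) (auto simp: has_bochner_integral_iff)
  also have "(LINT x|lborel. ?f n x) = sqrt (pi * \<xi>) * (fact (2 * n) / fact n) * \<xi> ^ n"
    by (rule has_bochner_integral_integral_eq[OF has_bochner_integral_half_gaussian_moment[OF \<xi>]])
  also have "(LINT x|lborel. ?f 0 x) = sqrt (pi * \<xi>)"
    using has_bochner_integral_integral_eq[OF has_bochner_integral_half_gaussian_moment[OF \<xi>, of 0]] by simp
  also have "1 / (2 * pi * \<xi>) * (sqrt (pi * \<xi>) * (fact (2 * n) / fact n) * \<xi> ^ n * sqrt (pi * \<xi>)) =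
      1 / (2 * pi * \<xi>) * (sqrt (pi * \<xi>) * sqrt (pi * \<xi>)) * (fact (2 * n) / fact n * \<xi> ^ n)"
    by (simp only: mult_ac)
  also have "sqrt (pi * \<xi>) * sqrt (pi * \<xi>) = pi * \<xi>" using \<xi> by simp
  finally show ?thesis using True by simp
qed (simp add: kern_def)

lemma integrable_kern_integral_norm_power:
  assumes "0 < T"
  shows "integrable lborel (\<lambda>x. kern_integral T x * ((norm x)\<^sup>2) ^ n)"
proof -
  \<comment> \<open>The zero sequence satisfies the locale trivially and gives access to
    \<open>w_power_exp_integrable\<close>.\<close>
  interpret vanishing_moments lborel "\<lambda>x. (norm x)\<^sup>2" "kern_integral T" "\<lambda>_ _. 0" "1 / (8 * T)"
    by standard (use assms integrable_kern_integral_exp[OF assms] in \<open>auto simp: kern_integral_nonneg\<close>)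
  show ?thesis using w_power_exp_integrable[of 0 n] assms by simp
qed

lemma integrable_quadrant_weight:
  fixes f :: "real \<times> real \<Rightarrow> complex"
  assumes "0 < T" and [measurable]: "f \<in> borel_measurable borel"
    and le: "AE x in lborel. cmod (f x) \<le> C * kern_integral T x"
  shows "integrable lborel (\<lambda>x. quadrant_weight n x *\<^sub>R f x)"
proof (rule Bochner_Integration.integrable_bound)
  show "integrable lborel (\<lambda>x. C * (kern_integral T x * ((norm x)\<^sup>2) ^ n))"
    using integrable_kern_integral_norm_power[OF assms(1)] by simp
  show "AE x in lborel. norm (quadrant_weight n x *\<^sub>R f x) \<le> norm (C * (kern_integral T x * ((norm x)\<^sup>2) ^ n))"
    using le
  proof eventually_elim
    case (elim x)
    have "quadrant_weight n x * cmod (f x) \<le> ((norm x)\<^sup>2) ^ n * (C * kern_integral T x)"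
      by (intro mult_mono quadrant_weight_le elim) auto
    also have "\<dots> = C * (kern_integral T x * ((norm x)\<^sup>2) ^ n)" by simp
    finally show ?case by (simp add: quadrant_weight_nonneg)
  qed
qed measurable

text \<open>The constant times \<open>- 2 * (fact n / fact (2 * n))\<close> is -1. Hence power
  moments equal to \<open>omega\<close> mean quadrant moments opposite to those of the
  target.\<close>

lemma (in bounded_control) integral_quadrant_weight_potential:
  "(LINT x|lborel. quadrant_weight n x *\<^sub>R potential T v x) =
    complex_of_real (fact (2 * n) / (2 * fact n)) *
      (LINT \<xi>:{0<..<T}|lborel. complex_of_real (\<xi> ^ n) * v \<xi>)"
proof -
  have int: "integrable lborel (\<lambda>x. kern_integral T x * cmod (complex_of_real (quadrant_weight n x)))"
  proof (rule Bochner_Integration.integrable_bound[OF integrable_kern_integral_norm_power[OF T_pos, of n]])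
    show "AE x in lborel. norm (kern_integral T x * cmod (complex_of_real (quadrant_weight n x)))
        \<le> norm (kern_integral T x * ((norm x)\<^sup>2) ^ n)"
      using mult_left_mono[OF quadrant_weight_le kern_integral_nonneg]
      by (simp add: kern_integral_nonneg quadrant_weight_nonneg abs_mult)
  qed measurable
  have "(LINT x|lborel. quadrant_weight n x *\<^sub>R potential T v x) =
      (LINT \<xi>|lborel. (LINT x|lborel. kern T x \<xi> *\<^sub>R complex_of_real (quadrant_weight n x)) * v \<xi>)"
    using integral_mult_potential[OF _ int] by (simp add: scaleR_conv_of_real)
  also have "\<dots> = (LINT \<xi>|lborel. complex_of_real (fact (2 * n) / (2 * fact n)) *
      (indicator {0<..<T} \<xi> *\<^sub>R (complex_of_real (\<xi> ^ n) * v \<xi>)))"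
  proof (rule Bochner_Integration.integral_cong[OF refl])
    fix \<xi>
    have "(LINT x|lborel. kern T x \<xi> *\<^sub>R complex_of_real (quadrant_weight n x)) =
        complex_of_real (LINT x|lborel. quadrant_weight n x * kern T x \<xi>)"
      by (simp add: scaleR_conv_of_real mult.commute flip: of_real_mult)
    then show "(LINT x|lborel. kern T x \<xi> *\<^sub>R complex_of_real (quadrant_weight n x)) * v \<xi> =
        complex_of_real (fact (2 * n) / (2 * fact n)) *
          (indicator {0<..<T} \<xi> *\<^sub>R (complex_of_real (\<xi> ^ n) * v \<xi>))"
      unfolding integral_quadrant_weight_kern by (simp add: indicator_def)
  qed
  also have "\<dots> = complex_of_real (fact (2 * n) / (2 * fact n)) *
      (LINT \<xi>:{0<..<T}|lborel. complex_of_real (\<xi> ^ n) * v \<xi>)"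
    unfolding set_lebesgue_integral_def by (rule integral_mult_right_zero)
  finally show ?thesis .
qed

lemma omega_eq:
  assumes "integrable lborel (\<lambda>x. quadrant_weight n x *\<^sub>R F x)"
  shows "omega F n = - 2 * (fact n / fact (2 * n)) * (LINT x|lborel. quadrant_weight n x *\<^sub>R F x)"
proof -
  have "integrable (lborel \<Otimes>\<^sub>M lborel) (\<lambda>x. quadrant_weight n x *\<^sub>R F x)"
    using assms by (simp add: lborel_prod)
  then have i: "integrable (lborel \<Otimes>\<^sub>M lborel) (\<lambda>(x, y). quadrant_weight n (x, y) *\<^sub>R F (x, y))"
    by (simp add: case_prod_beta')
  have "(LINT x|lborel. quadrant_weight n x *\<^sub>R F x) =
      (LINT y|lborel. LINT x|lborel. quadrant_weight n (x, y) *\<^sub>R F (x, y))"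
    using lborel_pair.integral_snd[OF i] by (simp add: lborel_prod case_prod_beta')
  also have "\<dots> = (LINT y|lborel. LINT x|lborel. indicator {0<..} y *\<^sub>R (indicator {0<..} x *\<^sub>R
      (complex_of_real (x ^ (2 * n)) * F (x, y))))"
    by (intro Bochner_Integration.integral_cong refl)
      (auto simp: quadrant_weight_def indicator_def scaleR_conv_of_real)
  also have "\<dots> = (LINT y|lborel. indicator {0<..} y *\<^sub>R (LINT x|lborel. indicator {0<..} x *\<^sub>R
      (complex_of_real (x ^ (2 * n)) * F (x, y))))"
    by (intro Bochner_Integration.integral_cong refl integral_scaleR_right)
  finally show ?thesis
    by (simp add: omega_def set_lebesgue_integral_def)
qed

section \<open>Approximate controllability\<close>

text \<open>A diagonal map with entries -1 and 1, whose determinant has modulus 1.\<close>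

lemma lborel_reflect: "distr lborel borel (\<lambda>x. (- fst x, snd x)) = (lborel :: (real \<times> real) measure)"
proof -
  define c where "c j = (if j = (1, 0) then - 1 else 1 :: real)" for j :: "real \<times> real"
  have "0 + (\<Sum>j\<in>Basis. (c j * (x \<bullet> j)) *\<^sub>R j) = (- fst x, snd x)" for x :: "real \<times> real"
    by (simp add: Basis_prod_def c_def sum.union_disjoint inner_Pair_0)
  moreover have "(\<Prod>j\<in>Basis. \<bar>c j\<bar>) = 1"
    by (intro prod.neutral) (simp add: c_def)
  moreover have "lborel = density (distr lborel borel (\<lambda>x. 0 + (\<Sum>j\<in>Basis. (c j * (x \<bullet> j)) *\<^sub>R j)))
      (\<lambda>_. (\<Prod>j\<in>Basis. \<bar>c j\<bar>))"
    by (rule lborel_affine_euclidean) (simp add: c_def)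
  ultimately show ?thesis by (simp add: density_1)
qed

lemma AE_reflect:
  fixes P :: "real \<times> real \<Rightarrow> bool"
  assumes "AE x in lborel. P x"
  shows "AE x in lborel. P (- fst x, snd x)"
proof -
  have "(\<lambda>x. (- fst x, snd x)) \<in> borel_measurable (borel :: (real \<times> real) measure)"
    by (intro borel_measurable_continuous_onI continuous_intros)
  then have r: "(\<lambda>x :: real \<times> real. (- fst x, snd x)) \<in> lborel \<rightarrow>\<^sub>M borel" by simp
  show ?thesis
    using AE_distrD[OF r, of P] assms unfolding lborel_reflect by simp
qed

theorem corollary3p12:
  fixes L T :: real and W0 WT W0T :: "real \<times> real \<Rightarrow> complex"
  assumes "L > 0" and "T > 0"
    and "W0 \<in> hat_H0" and "WT \<in> hat_H0"
    and "W0T = (\<lambda>x. WT x - W_free W0 T x)"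
    and "W0T \<in> cal_H"
    and "AE x in lborel. x \<noteq> 0 \<longrightarrow>
           cmod (W0T x) \<le> L / (2 * pi) * exp (- (norm x)\<^sup>2 / (4 * T)) * ln (1 + 4 * T / (norm x)\<^sup>2)"
    and "\<And>N::nat. \<exists>u \<in> Linf (lborel_interval T). Linf_norm (lborel_interval T) u \<le> ereal L \<and>
           (\<forall>n\<le>N. (LINT \<xi>:{0<..<T}|lborel. complex_of_real (\<xi> ^ n) * u (T - \<xi>)) = omega W0T n)"
  shows "approx_controllable W0 WT T"
proof -

  \<comment> \<open>Radial profile of the target, controls and vanishing moments\<close>
  let ?E = "kern_integral T" and ?q = "\<lambda>x :: real \<times> real. (norm x)\<^sup>2"
  have [measurable]: "cnj \<in> borel_measurable borel"
    by (intro borel_measurable_continuous_onI continuous_intros)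
  have W0T [measurable]: "W0T \<in> borel_measurable borel" and W0T2: "integrable lborel (\<lambda>x. (cmod (W0T x))\<^sup>2)"
    using assms(6) by (auto simp: cal_H_def L2_def)
  obtain g0 where g0': "g0 \<in> borel_measurable (restrict_space lborel {0<..})"
    and g0: "AE x in lborel. W0T x = g0 (?q x)"
    using assms(6) by (auto simp: cal_H_def L2_def)
  \<comment> \<open>Extension by 0 gives a profile that is Borel on the whole line; it changes
    \<open>g0\<close> only outside the values of the squared norm at nonzero points.\<close>
  define g where "g s = indicator {0<..} s *\<^sub>R g0 s" for s :: real
  have [measurable]: "g \<in> borel_measurable borel"
    using g0' unfolding g_def [abs_def]
    by (subst (asm) borel_measurable_restrict_space_iff) auto
  have g: "AE x in lborel. W0T x = g (?q x)"
    using g0 AE_plane_nonzero by eventually_elim (simp add: g_def)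
  \<comment> \<open>The logarithmic bound enters through this domination, so that target and
    potentials share the majorant \<open>?E\<close> up to constants.\<close>
  have W0T_le: "AE x in lborel. cmod (W0T x) \<le> L * exp 1 * ?E x"
    using assms(7) AE_plane_nonzero
  proof eventually_elim
    case (elim x)
    then have "cmod (W0T x) \<le> L * (1 / (2 * pi) * exp (- ?q x / (4 * T)) * ln (1 + 4 * T / ?q x))"
      by simp
    also have "\<dots> \<le> L * (exp 1 * ?E x)"
      using assms(1,2) elim by (intro mult_left_mono exp_ln_le_kern_integral) auto
    finally show ?case by simp
  qed

  \<comment> \<open>Bundling the control with its reversed extension allows one choice of both
    sequences.\<close>
  define admissible where "admissible N u v \<longleftrightarrow> u \<in> Linf (lborel_interval T) \<and> v \<in> borel_measurable borel \<and>
      (AE \<xi> in lborel. cmod (v \<xi>) \<le> L) \<and> (\<forall>\<xi>\<in>{0<..<T}. v \<xi> = u (T - \<xi>)) \<and>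
      (\<forall>n\<le>N. (LINT \<xi>:{0<..<T}|lborel. complex_of_real (\<xi> ^ n) * v \<xi>) = omega W0T n)"
    for N :: nat and u v
  have "\<exists>u v. admissible N u v" for N
  proof -
    obtain u where u: "u \<in> Linf (lborel_interval T)" "Linf_norm (lborel_interval T) u \<le> ereal L"
      and m: "\<And>n. n \<le> N \<Longrightarrow> (LINT \<xi>:{0<..<T}|lborel. complex_of_real (\<xi> ^ n) * u (T - \<xi>)) = omega W0T n"
      using assms(8)[of N] by auto
    obtain v where v: "v \<in> borel_measurable borel" "AE \<xi> in lborel. cmod (v \<xi>) \<le> L"
      "\<And>\<xi>. \<xi> \<in> {0<..<T} \<Longrightarrow> v \<xi> = u (T - \<xi>)"
      using reversed_control[OF u] assms(1) by auto
    have "(LINT \<xi>:{0<..<T}|lborel. complex_of_real (\<xi> ^ n) * v \<xi>) =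
        (LINT \<xi>:{0<..<T}|lborel. complex_of_real (\<xi> ^ n) * u (T - \<xi>))" for n
      by (rule set_lebesgue_integral_cong) (auto simp: v)
    with u v m have "admissible N u v" by (simp add: admissible_def)
    then show ?thesis by blast
  qed
  then obtain u v where uv: "\<And>N. admissible N (u N) (v N)" by metis
  then have u: "\<And>N. u N \<in> Linf (lborel_interval T)"
    and v [measurable]: "\<And>N. v N \<in> borel_measurable borel" and v_le: "\<And>N. AE \<xi> in lborel. cmod (v N \<xi>) \<le> L"
    and vu: "\<And>N \<xi>. \<xi> \<in> {0<..<T} \<Longrightarrow> v N \<xi> = u N (T - \<xi>)"
    and v_moment: "\<And>N n. n \<le> N \<Longrightarrow>
      (LINT \<xi>:{0<..<T}|lborel. complex_of_real (\<xi> ^ n) * v N \<xi>) = omega W0T n"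
    by (simp_all add: admissible_def)
  have ctrl: "bounded_control T L (v N)" for N
    using assms(1,2) v_le by unfold_locales auto
  note [measurable] = bounded_control.potential_measurable[OF ctrl]

  \<comment> \<open>The residual: the plus sign occurs because the control part of the state is
    minus the potential. The majorant \<open>w\<close> adds the bounds of both summands.\<close>
  define h where "h N x = W0T x + potential T (v N) x" for N x
  define w where "w x = L * (exp 1 + 1) * ?E x" for x
  have h_borel [measurable]: "h N \<in> borel_measurable borel" for N
    unfolding h_def [abs_def] by measurable
  have [measurable]: "w \<in> borel_measurable borel"
    unfolding w_def [abs_def] by measurable
  have potential_le: "AE x in lborel. cmod (potential T (v N) x) \<le> L * ?E x" for N
    using AE_plane_nonzero by eventually_elim (rule bounded_control.cmod_potential_le[OF ctrl])
  have h_le: "AE x in lborel. cmod (h N x) \<le> w x" for N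
    using W0T_le potential_le[of N]
  proof eventually_elim
    case (elim x)
    then show ?case
      using norm_triangle_ineq[of "W0T x" "potential T (v N) x"]
      by (simp add: h_def w_def algebra_simps)
  qed
  define k where "k N s = g s + (LINT \<xi>|lborel.
    (indicator {0<..<T} \<xi> * (exp (- s / (4 * \<xi>)) / (2 * pi * \<xi>))) *\<^sub>R v N \<xi>)" for N s
  have [measurable]: "k N \<in> borel_measurable borel" for N
    unfolding k_def [abs_def] by measurable
  have h_radial: "AE x in lborel. h N x = k N (?q x)" for N
    using g by eventually_elim (simp add: h_def k_def bounded_control.potential_radial[OF ctrl])

  \<comment> \<open>The quadrant moments of the two summands cancel by the normalisation of
    \<open>omega\<close>; radiality then carries this over to the moments on the whole
    plane.\<close>
  have moment_0: "(LINT x|lborel. h N x * complex_of_real (?q x ^ n)) = 0" if "n \<le> N" for n N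
  proof -
    have iF: "integrable lborel (\<lambda>x. quadrant_weight n x *\<^sub>R W0T x)"
      by (rule integrable_quadrant_weight[OF assms(2) W0T W0T_le])
    have iP: "integrable lborel (\<lambda>x. quadrant_weight n x *\<^sub>R potential T (v N) x)"
      by (rule integrable_quadrant_weight[OF assms(2) _ potential_le]) measurable
    have "(LINT x|lborel. quadrant_weight n x *\<^sub>R k N (?q x)) = (LINT x|lborel. quadrant_weight n x *\<^sub>R h N x)"
      by (rule integral_cong_AE) (use h_radial[of N] in \<open>auto elim!: eventually_mono\<close>)
    also have "\<dots> = (LINT x|lborel. quadrant_weight n x *\<^sub>R W0T x) +
        (LINT x|lborel. quadrant_weight n x *\<^sub>R potential T (v N) x)"
      unfolding h_def scaleR_add_right by (rule Bochner_Integration.integral_add[OF iF iP])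
    also have "(LINT x|lborel. quadrant_weight n x *\<^sub>R potential T (v N) x) =
        complex_of_real (fact (2 * n) / (2 * fact n)) * omega W0T n"
      unfolding bounded_control.integral_quadrant_weight_potential[OF ctrl] v_moment[OF that] ..
    also have "\<dots> = - (LINT x|lborel. quadrant_weight n x *\<^sub>R W0T x)"
      by (simp add: omega_eq[OF iF])
    finally have "(LINT x|lborel. quadrant_weight n x *\<^sub>R k N (?q x)) = 0" by simp
    then have "(LINT x|lborel. (?q x) ^ n *\<^sub>R k N (?q x)) = 0"
      by (rule radial_moment_eq_0[rotated]) measurable
    moreover have "(LINT x|lborel. h N x * complex_of_real (?q x ^ n)) = (LINT x|lborel. (?q x) ^ n *\<^sub>R k N (?q x))"
      by (rule integral_cong_AE)
        (use h_radial[of N] in \<open>auto elim!: eventually_mono simp: scaleR_conv_of_real\<close>)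
    ultimately show ?thesis by simp
  qed

  \<comment> \<open>For fixed \<open>n\<close> the moments are exactly 0 as soon as
    \<open>N \<ge> n\<close>.\<close>
  interpret vanishing_moments lborel ?q w h "1 / (8 * T)"
  proof unfold_locales
    show "integrable lborel (\<lambda>x. w x * exp (1 / (8 * T) * ?q x))"
      using integrable_mult_right[OF integrable_kern_integral_exp[OF assms(2)], of "L * (exp 1 + 1)"]
      by (simp add: w_def mult.assoc)
    show "(\<lambda>N. LINT x|lborel. h N x * complex_of_real (?q x ^ n)) \<longlonglongrightarrow> 0" for n
      by (rule tendsto_eventually) (use moment_0 in \<open>auto simp: eventually_sequentially\<close>)
  qed (use assms(2) h_le in auto)

  \<comment> \<open>From weak to strong convergence of the residuals\<close>
  have E2: "integrable lborel (\<lambda>x. (?E x)\<^sup>2)"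
    by (rule integrable_kern_integral_square[OF assms(2)])
  have int_E: "integrable lborel (\<lambda>x. ?E x * cmod (\<phi> x))"
    if [measurable]: "\<phi> \<in> borel_measurable borel" and le: "AE x in lborel. cmod (\<phi> x) \<le> C * ?E x"
    for \<phi> :: "real \<times> real \<Rightarrow> complex" and C
  proof (rule Bochner_Integration.integrable_bound[OF integrable_mult_right[OF E2, of C]])
    show "AE x in lborel. norm (?E x * cmod (\<phi> x)) \<le> norm (C * (?E x)\<^sup>2)"
      using le
    proof eventually_elim
      case (elim x)
      have "?E x * cmod (\<phi> x) \<le> ?E x * (C * ?E x)"
        by (intro mult_left_mono elim kern_integral_nonneg)
      also have "\<dots> = C * (?E x)\<^sup>2" by (simp add: power2_eq_square)
      finally show ?case by (simp add: kern_integral_nonneg)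
    qed
  qed measurable
  have int_w: "integrable lborel (\<lambda>x. w x * cmod (\<phi> x))"
    if "\<phi> \<in> borel_measurable borel" "AE x in lborel. cmod (\<phi> x) \<le> C * ?E x"
    for \<phi> :: "real \<times> real \<Rightarrow> complex" and C
    using integrable_mult_right[OF int_E[OF that], of "L * (exp 1 + 1)"]
    by (simp add: w_def mult.assoc)
  have h_le_E: "AE x in lborel. cmod (h N x) \<le> L * (exp 1 + 1) * ?E x" for N
    using h_le by (simp add: w_def)

  have weak_W0T: "(\<lambda>N. LINT x|lborel. h N x * cnj (W0T x)) \<longlonglongrightarrow> 0"
  proof -
    have "integrable lborel (\<lambda>x. w x * cmod (W0T x))"
      by (rule int_w[OF W0T W0T_le])
    then have "integrable lborel (\<lambda>x. w x * cmod (cnj (g (?q x))))"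
      by (rule integrable_cong_AE_imp) (use g in \<open>auto elim!: eventually_mono\<close>)
    then have "weak_null (\<lambda>x. cnj (g (?q x)))"
      by (intro weak_null_compose[where g = "\<lambda>s. cnj (g s)"]) auto
    then have "(\<lambda>N. LINT x|lborel. h N x * cnj (g (?q x))) \<longlonglongrightarrow> 0"
      by (simp add: weak_null_def)
    moreover have "(LINT x|lborel. h N x * cnj (g (?q x))) = (LINT x|lborel. h N x * cnj (W0T x))" for N
      by (rule integral_cong_AE) (use g in \<open>auto elim!: eventually_mono\<close>)
    ultimately show ?thesis by simp
  qed

  \<comment> \<open>The potentials vary with \<open>N\<close>, so weak convergence does not apply to
    them directly. Instead \<open>h N\<close> is paired with each fixed Gaussian slice of the
    kernel, which is weakly null, and the pairings are then integrated in time.\<close>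
  define \<rho> where "\<rho> N \<xi> = (LINT x|lborel. kern T x \<xi> *\<^sub>R h N x)" for N \<xi>
  have [measurable]: "\<rho> N \<in> borel_measurable borel" for N
    unfolding \<rho>_def [abs_def] by measurable
  have \<rho>_lim: "(\<lambda>N. cmod (\<rho> N \<xi>)) \<longlonglongrightarrow> 0" for \<xi>
  proof (cases "\<xi> \<in> {0<..<T}")
    case True
    have "weak_null (\<lambda>x. complex_of_real (1 / (2 * pi * \<xi>)) * complex_of_real (?q x ^ 0 * exp (- (1 / (4 * \<xi>)) * ?q x)))"
      using True by (intro weak_null_cmult weak_null_power_exp) auto
    moreover have "complex_of_real (1 / (2 * pi * \<xi>)) * complex_of_real (?q x ^ 0 * exp (- (1 / (4 * \<xi>)) * ?q x)) =
        complex_of_real (kern T x \<xi>)" for x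
      using True by (simp add: kern_def)
    ultimately have "weak_null (\<lambda>x. complex_of_real (kern T x \<xi>))"
      by (simp only:)
    then have "(\<lambda>N. \<rho> N \<xi>) \<longlonglongrightarrow> 0"
      by (simp add: weak_null_def \<rho>_def scaleR_conv_of_real mult.commute)
    then show ?thesis by (rule tendsto_norm_zero)
  qed (simp add: \<rho>_def kern_def)
  \<comment> \<open>Square integrability of \<open>?E\<close> makes \<open>?E * w\<close>
    integrable; this gives a dominating function of time for all \<open>\<rho> N\<close>.\<close>
  have int_kern_w: "integrable (lborel \<Otimes>\<^sub>M lborel) (\<lambda>(x, \<xi>). kern T x \<xi> *\<^sub>R complex_of_real (w x))"
  proof (rule integrable_kern_mult)
    show "integrable lborel (\<lambda>x. ?E x * cmod (complex_of_real (w x)))"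
    proof (rule int_E)
      have "0 \<le> w x" for x using assms(1) by (simp add: w_def kern_integral_nonneg)
      then show "AE x in lborel. cmod (complex_of_real (w x)) \<le> L * (exp 1 + 1) * ?E x"
        unfolding norm_of_real by (simp add: w_def)
    qed measurable
  qed measurable
  have kern_w: "integrable lborel (\<lambda>\<xi>. LINT x|lborel. kern T x \<xi> * w x)"
    "AE \<xi> in lborel. integrable lborel (\<lambda>x. kern T x \<xi> * w x)"
  proof -
    have "integrable (lborel \<Otimes>\<^sub>M lborel) (\<lambda>p. Re (case p of (x, \<xi>) \<Rightarrow> kern T x \<xi> *\<^sub>R complex_of_real (w x)))"
      using int_kern_w by (rule integrable_Re)
    then have *: "integrable (lborel \<Otimes>\<^sub>M lborel) (\<lambda>(x, \<xi>). kern T x \<xi> * w x)"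
      by (simp add: split_beta')
    show "integrable lborel (\<lambda>\<xi>. LINT x|lborel. kern T x \<xi> * w x)"
      by (rule lborel_pair.integrable_snd[OF *])
    show "AE \<xi> in lborel. integrable lborel (\<lambda>x. kern T x \<xi> * w x)"
      by (rule lborel_pair.AE_integrable_snd[OF *])
  qed
  have \<rho>_le: "AE \<xi> in lborel. norm (cmod (\<rho> N \<xi>)) \<le> (LINT x|lborel. kern T x \<xi> * w x)" for N
    using kern_w(2)
  proof eventually_elim
    case (elim \<xi>)
    have le: "AE x in lborel. norm (kern T x \<xi> *\<^sub>R h N x) \<le> kern T x \<xi> * w x"
      using h_le[of N] by eventually_elim (simp add: kern_nonneg mult_left_mono)
    have "cmod (\<rho> N \<xi>) \<le> (LINT x|lborel. kern T x \<xi> * w x)"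
      unfolding \<rho>_def by (rule norm_integral_dominated[OF _ elim le]) measurable
    then show ?case by simp
  qed
  have \<rho>_integral: "(\<lambda>N. LINT \<xi>|lborel. cmod (\<rho> N \<xi>)) \<longlonglongrightarrow> (LINT \<xi>::real|lborel. 0)"
    by (rule integral_dominated_convergence[OF _ _ kern_w(1) _ \<rho>_le]) (use \<rho>_lim in auto)
  have \<rho>_integrable: "integrable lborel (\<lambda>\<xi>. cmod (\<rho> N \<xi>))" for N
    by (rule integrable_dominated[OF _ kern_w(1) \<rho>_le]) measurable

  \<comment> \<open>Conjugating the control conjugates the potential, so Fubini turns the pairing
    into the integral of \<open>\<rho> N\<close> against the conjugate control, bounded by
    \<open>L\<close>.\<close>
  have weak_potential: "(\<lambda>N. LINT x|lborel. h N x * cnj (potential T (v N) x)) \<longlonglongrightarrow> 0"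
  proof (rule Lim_null_comparison)
    show "(\<lambda>N. L * (LINT \<xi>|lborel. cmod (\<rho> N \<xi>))) \<longlonglongrightarrow> 0"
      using tendsto_mult_left[OF \<rho>_integral, of L] by simp
    show "\<forall>\<^sub>F N in sequentially. cmod (LINT x|lborel. h N x * cnj (potential T (v N) x))
        \<le> L * (LINT \<xi>|lborel. cmod (\<rho> N \<xi>))"
    proof (intro always_eventually allI)
      fix N
      have conj: "bounded_control T L (\<lambda>\<xi>. cnj (v N \<xi>))"
        using assms(1,2) v_le by unfold_locales auto
      have "cnj (potential T (v N) x) = potential T (\<lambda>\<xi>. cnj (v N \<xi>)) x" for x
        by (simp add: potential_def flip: Bochner_Integration.integral_cnj)
      then have "(LINT x|lborel. h N x * cnj (potential T (v N) x)) = (LINT \<xi>|lborel. \<rho> N \<xi> * cnj (v N \<xi>))"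
        using bounded_control.integral_mult_potential[OF conj h_borel int_E[OF h_borel h_le_E], of N]
        by (simp add: \<rho>_def)
      also have "cmod \<dots> \<le> (LINT \<xi>|lborel. L * cmod (\<rho> N \<xi>))"
      proof (rule norm_integral_dominated)
        show "AE \<xi> in lborel. norm (\<rho> N \<xi> * cnj (v N \<xi>)) \<le> L * cmod (\<rho> N \<xi>)"
          using v_le[of N] by eventually_elim (simp add: norm_mult mult.commute[of L] mult_left_mono)
        show "integrable lborel (\<lambda>\<xi>. L * cmod (\<rho> N \<xi>))"
          using \<rho>_integrable by simp
      qed measurable
      finally show "cmod (LINT x|lborel. h N x * cnj (potential T (v N) x))
        \<le> L * (LINT \<xi>|lborel. cmod (\<rho> N \<xi>))" by simp
    qed
  qed

  have h2: "integrable lborel (\<lambda>x. (cmod (h N x))\<^sup>2)" for N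
  proof (rule Bochner_Integration.integrable_bound[OF int_w[OF h_borel h_le_E[of N]]])
    show "AE x in lborel. norm ((cmod (h N x))\<^sup>2) \<le> norm (w x * cmod (h N x))"
      using h_le[of N] by eventually_elim (simp add: power2_eq_square abs_mult mult_right_mono)
  qed measurable
  have "(\<lambda>N. LINT x|lborel. (cmod (h N x))\<^sup>2) \<longlonglongrightarrow> 0"
  proof -
    \<comment> \<open>One factor of \<open>h N * cnj (h N)\<close> is expanded into target plus
      potential.\<close>
    have "complex_of_real (LINT x|lborel. (cmod (h N x))\<^sup>2) =
        (LINT x|lborel. h N x * cnj (W0T x)) + (LINT x|lborel. h N x * cnj (potential T (v N) x))" for N
    proof -
      have "complex_of_real (LINT x|lborel. (cmod (h N x))\<^sup>2) =
          (LINT x|lborel. h N x * cnj (W0T x) + h N x * cnj (potential T (v N) x))"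
        by (simp only: complex_norm_square h_def complex_cnj_add distrib_left flip: integral_complex_of_real)
      also have "\<dots> = (LINT x|lborel. h N x * cnj (W0T x)) + (LINT x|lborel. h N x * cnj (potential T (v N) x))"
      proof (rule Bochner_Integration.integral_add)
        show "integrable lborel (\<lambda>x. h N x * cnj (W0T x))"
          using int_w[OF W0T W0T_le] by (intro h_mult_integrable) auto
        have "integrable lborel (\<lambda>x. w x * cmod (potential T (v N) x))"
          by (rule int_w[OF _ potential_le]) measurable
        then show "integrable lborel (\<lambda>x. h N x * cnj (potential T (v N) x))"
          by (intro h_mult_integrable) auto
      qed
      finally show ?thesis .
    qed
    then have "(\<lambda>N. complex_of_real (LINT x|lborel. (cmod (h N x))\<^sup>2)) \<longlonglongrightarrow> of_real 0"
      using tendsto_add[OF weak_W0T weak_potential] by simp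
    then show ?thesis by (simp only: tendsto_of_real_iff)
  qed
  from tendsto_real_sqrt[OF this] have norm_lim: "(\<lambda>N. L2_norm lborel (h N)) \<longlonglongrightarrow> 0"
    by (simp add: L2_norm_def)

  \<comment> \<open>Reachability of the approximating states\<close>
  have WT [measurable]: "WT \<in> borel_measurable borel" and WT2: "integrable lborel (\<lambda>x. (cmod (WT x))\<^sup>2)"
    and WT_even: "AE x in lborel. WT (- fst x, snd x) = WT x"
    using assms(4) by (auto simp: hat_H0_def L2_def)
  define V where "V N x = W_free W0 T x + W_ctrl (u N) T x" for N x
  have V: "V N = (\<lambda>x. WT x - h N x)" for N
    using W_ctrl_eq_potential[where u = "u N" and v = "v N", OF vu] by (simp add: V_def h_def assms(5) fun_eq_iff)
  have V_reachable: "V N \<in> reachable T W0" for N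
  proof -
    have "integrable lborel (\<lambda>x. (cmod (V N x))\<^sup>2)"
    proof (rule Bochner_Integration.integrable_bound)
      show "integrable lborel (\<lambda>x. 2 * (cmod (WT x))\<^sup>2 + 2 * (cmod (h N x))\<^sup>2)"
        using WT2 h2 by simp
      have "(cmod (WT x - h N x))\<^sup>2 \<le> 2 * (cmod (WT x))\<^sup>2 + 2 * (cmod (h N x))\<^sup>2" for x
      proof -
        have "(cmod (WT x - h N x))\<^sup>2 \<le> (cmod (WT x) + cmod (h N x))\<^sup>2"
          by (intro power_mono norm_triangle_ineq4) auto
        also have "\<dots> \<le> 2 * (cmod (WT x))\<^sup>2 + 2 * (cmod (h N x))\<^sup>2"
          using sum_squares_bound[of "cmod (WT x)" "cmod (h N x)"] by (simp add: power2_sum)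
        finally show ?thesis .
      qed
      then show "AE x in lborel. norm ((cmod (V N x))\<^sup>2) \<le> norm (2 * (cmod (WT x))\<^sup>2 + 2 * (cmod (h N x))\<^sup>2)"
        by (simp add: V)
    qed (simp add: V)
    \<comment> \<open>Evenness of the residual comes from its radial profile, used almost everywhere
      both at \<open>x\<close> and at the reflected point.\<close>
    moreover have "AE x in lborel. V N (- fst x, snd x) = V N x"
      using WT_even h_radial[of N] AE_reflect[OF h_radial[of N]]
      by eventually_elim (simp add: V norm_prod_square)
    moreover have "V N \<in> borel_measurable borel" by (simp add: V)
    ultimately have "V N \<in> hat_H0" by (simp add: hat_H0_def L2_def)
    with u[of N] show ?thesis by (auto simp: reachable_def V_def)
  qed
  have "\<exists>f\<in>reachable T W0. L2_norm lborel (\<lambda>x. WT x - f x) < \<epsilon>" if pos: "\<epsilon> > 0" for \<epsilon>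
  proof -
    obtain N where "L2_norm lborel (h N) < \<epsilon>"
      using order_tendstoD(2)[OF norm_lim pos] by (auto simp: eventually_sequentially)
    then show ?thesis
      by (intro bexI[OF _ V_reachable[of N]]) (simp add: V)
  qed
  with assms(4) show ?thesis
    by (simp add: approx_controllable_def hat_H0_closure_def)
qed

end
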